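(* There are absolute constants $k_0\in\mathbb N$ and $\alpha,\varepsilon>0$ such that for all integers $d\ge k\ge k_0$ and every $n\ge \alpha d^8k^6$ there is a pair of $k$-ary relational structures $\mathfrak A$ and $\mathfrak B$ with $|V(\mathfrak A)|=|V(\mathfrak B)|=n$ that are distinguished by $k$-WL, but $d$-WL does not distinguish $\mathfrak A$ and $\mathfrak B$ after $n^{\varepsilon k}$ refinement rounds.
   Context: A relational structure $\mathfrak A$ of arity at most $k$ consists of a finite universe $V(\mathfrak A)$ and relations $R_i^{\mathfrak A}\subseteq V(\mathfrak A)^{k_i}$ with $k_i\le k$; a $k$-ary structure is one whose relations have arity at most $k$. For $\vec v=(v_1,\dots,v_m)\in V(\mathfrak A)^m$, the atomic type $\mathrm{atp}_{\mathfrak A}(\vec v)$ is the isomorphism type of the ordered induced substructure on $\{v_1,\dots,v_m\}$ (two tuples in possibly different structures have the same atomic type iff $v_i\mapsto w_i$ is a well-defined isomorphism of the induced substructures). For a coloring $\chi$ of $V^m$, its $m$-WL refinement is $\chi'(\vec v)=\big(\chi(\vec v),\{\!\{(\chi(\vec v[w/1]),\dots,\chi(\vec v[w/m]))\mid w\in V\}\!\}\big)$, where $\vec v[w/i]$ replaces the $i$-th entry by $w$. The $m$-WL algorithm (for structures of arity at most $m$) computes $\chi^{(0)}_{\mathfrak A}=\mathrm{atp}_{\mathfrak A}$ on $V(\mathfrak A)^m$ and $\chi^{(r+1)}_{\mathfrak A}=(\chi^{(r)}_{\mathfrak A})'$, with colors defined uniformly so they can be compared across structures. $m$-WL distinguishes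 $\mathfrak A$ and $\mathfrak B$ after $r$ rounds if for some color $c$ the numbers of tuples of color $c$ under $\chi^{(r)}_{\mathfrak A}$ and under $\chi^{(r)}_{\mathfrak B}$ differ; it distinguishes them if it does so after some number of rounds. *)

theory Defs
  imports Complex_Main "HOL-Library.Multiset"
begin

text \<open>A signature is the list of arities of its relation symbols \<open>R\<^sub>0, \<dots>, R\<^sub>l\<close>; tuples are lists.
  Values of \<open>rel\<close> at indices outside the signature are ignored by everything below.\<close>

type_synonym signature = "nat list"

record 'a rel_struct =
  univ :: "'a set"
  rel :: "nat \<Rightarrow> 'a list set"

definition tuples :: "'a set \<Rightarrow> nat \<Rightarrow> 'a list set" where
  "tuples V m = {v. length v = m \<and> set v \<subseteq> V}"

definition relational_structure :: "signature \<Rightarrow> 'a rel_struct \<Rightarrow> bool" where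
  "relational_structure \<sigma> A \<longleftrightarrow>
     finite (univ A) \<and> (\<forall>i<length \<sigma>. rel A i \<subseteq> tuples (univ A) (\<sigma> ! i))"

definition kary_structure :: "nat \<Rightarrow> signature \<Rightarrow> 'a rel_struct \<Rightarrow> bool" where
  "kary_structure k \<sigma> A \<longleftrightarrow> relational_structure \<sigma> A \<and> (\<forall>a\<in>set \<sigma>. a \<le> k)"

definition induced :: "'a rel_struct \<Rightarrow> 'a set \<Rightarrow> 'a rel_struct" where
  "induced A X = \<lparr>univ = X, rel = (\<lambda>i. {xs \<in> rel A i. set xs \<subseteq> X})\<rparr>"

definition is_iso :: "signature \<Rightarrow> ('a \<Rightarrow> 'b) \<Rightarrow> 'a rel_struct \<Rightarrow> 'b rel_struct \<Rightarrow> bool" where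
  "is_iso \<sigma> f A B \<longleftrightarrow> bij_betw f (univ A) (univ B) \<and>
     (\<forall>i<length \<sigma>. \<forall>xs\<in>tuples (univ A) (\<sigma> ! i). xs \<in> rel A i \<longleftrightarrow> map f xs \<in> rel B i)"

text \<open>The isomorphism type of the ordered induced substructure on the entries of \<open>v\<close> is encoded by
  pulling equality and all relations back to the positions of \<open>v\<close>. That this encodes exactly the
  isomorphism type is lemma \<open>atp_eq_iff\<close>.\<close>

type_synonym atomic_type = "(nat \<times> nat) set \<times> nat list set list"

definition atp :: "signature \<Rightarrow> 'a rel_struct \<Rightarrow> 'a list \<Rightarrow> atomic_type" where
  "atp \<sigma> A v =
     ({(i, j). i < length v \<and> j < length v \<and> v ! i = v ! j},
      map (\<lambda>s. {js \<in> tuples {..<length v} (\<sigma> ! s). map ((!) v) js \<in> rel A s}) [0..<length \<sigma>])"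

lemma atp_eq_iff:
  "atp \<sigma> A v = atp \<sigma> B w \<longleftrightarrow>
     (\<exists>f. map f v = w \<and> is_iso \<sigma> f (induced A (set v)) (induced B (set w)))"
proof
  assume eq: "atp \<sigma> A v = atp \<sigma> B w"
  let ?E = "\<lambda>v. {(i, j). i < length v \<and> j < length v \<and> v ! i = v ! j}"
  have E: "?E v = ?E w" using eq by (simp add: atp_def)
  have len: "length v = length w"
  proof -
    have "i < length v \<longleftrightarrow> i < length w" for i
    proof -
      have "(i, i) \<in> ?E v \<longleftrightarrow> (i, i) \<in> ?E w" by (simp only: E)
      then show ?thesis by simp
    qed
    from this[of "length v"] this[of "length w"] show ?thesis by linarith
  qed
  have eqv: "v ! i = v ! j \<longleftrightarrow> w ! i = w ! j" if "i < length v" "j < length v" for i j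
  proof -
    have "(i, j) \<in> ?E v \<longleftrightarrow> (i, j) \<in> ?E w" by (simp only: E)
    then show ?thesis using that len by simp
  qed
  have R: "map ((!) v) js \<in> rel A s \<longleftrightarrow> map ((!) w) js \<in> rel B s"
    if "s < length \<sigma>" "js \<in> tuples {..<length v} (\<sigma> ! s)" for s js
  proof -
    have "{js \<in> tuples {..<length v} (\<sigma> ! s). map ((!) v) js \<in> rel A s} =
          {js \<in> tuples {..<length w} (\<sigma> ! s). map ((!) w) js \<in> rel B s}"
      using eq that(1) by (simp add: atp_def)
    from eqset_imp_iff[OF this, of js] show ?thesis using that(2) len by simp
  qed
  define p where "p x = (SOME i. i < length v \<and> v ! i = x)" for x
  define f where "f x = w ! p x" for x
  have p: "p x < length v \<and> v ! p x = x" if "x \<in> set v" for x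
    unfolding p_def by (rule someI_ex) (use that in \<open>simp add: in_set_conv_nth\<close>)
  have fv: "f (v ! i) = w ! i" if "i < length v" for i
    using p[of "v ! i"] eqv[of "p (v ! i)" i] that unfolding f_def by simp
  have map: "map f v = w"
    by (rule nth_equalityI) (use len fv in auto)
  have inj: "inj_on f (set v)"
  proof (rule inj_onI)
    fix x y assume "x \<in> set v" "y \<in> set v" "f x = f y"
    then show "x = y" using p[of x] p[of y] eqv[of "p x" "p y"] unfolding f_def by simp
  qed
  have bij: "bij_betw f (set v) (set w)"
    using inj map by (auto simp: bij_betw_def)
  have rels: "xs \<in> rel A s \<longleftrightarrow> map f xs \<in> rel B s"
    if "s < length \<sigma>" "xs \<in> tuples (set v) (\<sigma> ! s)" for s xs
  proof -
    have "map ((!) v) (map p xs) = xs"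
      using that(2) p by (auto simp: tuples_def intro!: map_idI)
    moreover have "map ((!) w) (map p xs) = map f xs" by (simp add: f_def)
    moreover have "map p xs \<in> tuples {..<length v} (\<sigma> ! s)"
      using that(2) p by (auto simp: tuples_def)
    ultimately show ?thesis using R[OF that(1)] by metis
  qed
  have sub: "set (map f xs) \<subseteq> set w" if "set xs \<subseteq> set v" for xs
    using that map by auto
  have "is_iso \<sigma> f (induced A (set v)) (induced B (set w))"
    using bij rels sub by (auto simp: is_iso_def induced_def tuples_def)
  then show "\<exists>f. map f v = w \<and> is_iso \<sigma> f (induced A (set v)) (induced B (set w))"
    using map by blast
next
  assume "\<exists>f. map f v = w \<and> is_iso \<sigma> f (induced A (set v)) (induced B (set w))"
  then obtain f where map: "map f v = w"
    and iso: "is_iso \<sigma> f (induced A (set v)) (induced B (set w))" by blast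
  have len: "length w = length v" using map by auto
  have w: "w ! i = f (v ! i)" if "i < length v" for i
    using map that by auto
  have inj: "inj_on f (set v)" using iso by (simp add: is_iso_def induced_def bij_betw_def)
  have E: "v ! i = v ! j \<longleftrightarrow> w ! i = w ! j" if "i < length v" "j < length v" for i j
    using that w inj by (metis inj_on_contraD nth_mem)
  have R: "map ((!) v) js \<in> rel A s \<longleftrightarrow> map ((!) w) js \<in> rel B s"
    if s: "s < length \<sigma>" and js: "js \<in> tuples {..<length v} (\<sigma> ! s)" for s js
  proof -
    have *: "map ((!) w) js = map f (map ((!) v) js)"
      using js w by (simp add: tuples_def subset_iff)
    have t: "map ((!) v) js \<in> tuples (set v) (\<sigma> ! s)"
      using js by (auto simp: tuples_def)
    have "set (map f (map ((!) v) js)) \<subseteq> set w"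
      using t map by (auto simp: tuples_def)
    then show ?thesis
      using iso s t unfolding * by (auto simp: is_iso_def induced_def tuples_def)
  qed
  show "atp \<sigma> A v = atp \<sigma> B w"
  proof -
    have "{(i, j). i < length v \<and> j < length v \<and> v ! i = v ! j} =
          {(i, j). i < length v \<and> j < length v \<and> w ! i = w ! j}"
      using E by blast
    moreover have "{js \<in> tuples {..<length v} (\<sigma> ! s). map ((!) v) js \<in> rel A s} =
          {js \<in> tuples {..<length v} (\<sigma> ! s). map ((!) w) js \<in> rel B s}" if "s < length \<sigma>" for s
      using R[OF that] by blast
    ultimately show ?thesis unfolding atp_def len by simp
  qed
qed

text \<open>Colors live in one type for all structures and all rounds, so that they can be compared across
  structures; \<open>Refined\<close> is the pairing of the old color with the multiset of color tuples.\<close>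

datatype wl_color =
  Atomic atomic_type
| Refined wl_color "wl_color list multiset"

definition wl_refine :: "nat \<Rightarrow> 'a set \<Rightarrow> ('a list \<Rightarrow> wl_color) \<Rightarrow> 'a list \<Rightarrow> wl_color" where
  "wl_refine m V \<chi> v =
     Refined (\<chi> v) (image_mset (\<lambda>w. map (\<lambda>i. \<chi> (v[i := w])) [0..<m]) (mset_set V))"

primrec wl :: "signature \<Rightarrow> nat \<Rightarrow> 'a rel_struct \<Rightarrow> nat \<Rightarrow> 'a list \<Rightarrow> wl_color" where
  "wl \<sigma> m A 0 = (\<lambda>v. Atomic (atp \<sigma> A v))"
| "wl \<sigma> m A (Suc r) = wl_refine m (univ A) (wl \<sigma> m A r)"

definition wl_distinguishes_after ::
    "signature \<Rightarrow> nat \<Rightarrow> nat \<Rightarrow> 'a rel_struct \<Rightarrow> 'b rel_struct \<Rightarrow> bool" where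
  "wl_distinguishes_after \<sigma> m r A B \<longleftrightarrow>
     (\<exists>c. card {v \<in> tuples (univ A) m. wl \<sigma> m A r v = c} \<noteq>
          card {v \<in> tuples (univ B) m. wl \<sigma> m B r v = c})"

definition wl_distinguishes ::
    "signature \<Rightarrow> nat \<Rightarrow> 'a rel_struct \<Rightarrow> 'b rel_struct \<Rightarrow> bool" where
  "wl_distinguishes \<sigma> m A B \<longleftrightarrow> (\<exists>r. wl_distinguishes_after \<sigma> m r A B)"

end

theory Submission
  imports Defs "HOL-Library.Z2" "HOL-Library.FuncSet" "HOL-Library.Function_Algebras"
    "HOL-Combinatorics.Permutations"
begin

text \<open>The structures encode a linear system over the two-element field; the second one has a twisted
  right-hand side. The system describes a deep circuit of XOR gates whose sources are \<open>0\<close> and whose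
  sink is required to be \<open>1\<close>. Walking down from the sink along wrong values needs only three pebbled
  vertices, so the structures are distinguished eventually. The wiring is chosen by counting such
  that, for every block of steps, a sum of few values before the block and a sum of few values after
  it never agree as functions of the input unless both vanish. Hence the input can be changed such
  that few given values before the block become \<open>0\<close> and few given values after it are kept.
  Duplicator answers \<open>0\<close> before some block and follows a run with output \<open>1\<close> after it, and has to
  lower this block only by about \<open>2 d\<close> blocks per round.

  To obtain \<open>n\<^bsup>\<Omega>(k)\<^esup>\<close> rounds, each of the \<open>n\<^bsup>\<Omega>(k)\<^esup>\<close> vertices of the circuit is replaced by the XOR of
  about \<open>k / 3\<close> out of \<open>n / 2\<close> variables along a bipartite expander (hardness condensation as in
  Berkholz and Nordstroem). By expansion, \<open>d\<close> pebbled variables determine only few circuit vertices,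
  and the remaining ones can be set freely through unique neighbours.\<close>

section \<open>The bijective game\<close>

lemma image_mset_mset_set_eq_iff:
  assumes "finite A" "finite B"
  shows "image_mset f (mset_set A) = image_mset g (mset_set B) \<longleftrightarrow>
    (\<exists>h. bij_betw h A B \<and> (\<forall>x\<in>A. f x = g (h x)))"
proof
  assume eq: "image_mset f (mset_set A) = image_mset g (mset_set B)"
  have "card A = card B" using arg_cong[OF eq, of size] by simp
  then obtain e where e: "bij_betw e A B" using assms finite_same_card_bij by blast
  then have "image_mset g (mset_set B) = image_mset (g \<circ> e) (mset_set A)"
    by (auto simp: bij_betw_def image_mset_mset_set simp flip: multiset.map_comp)
  with eq obtain p where p: "p permutes A" "\<forall>x\<in>A. f x = (g \<circ> e) (p x)"
    using image_mset_eq_implies_permutes[OF assms(1)] by metis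
  then show "\<exists>h. bij_betw h A B \<and> (\<forall>x\<in>A. f x = g (h x))"
    using bij_betw_trans[OF permutes_imp_bij[OF p(1)] e] by (intro exI[of _ "e \<circ> p"]) simp
next
  assume "\<exists>h. bij_betw h A B \<and> (\<forall>x\<in>A. f x = g (h x))"
  then obtain h where h: "bij_betw h A B" "\<And>x. x \<in> A \<Longrightarrow> f x = g (h x)" by blast
  have "image_mset f (mset_set A) = image_mset g (image_mset h (mset_set A))"
    using assms(1) h(2) by (auto simp: multiset.map_comp intro: image_mset_cong)
  then show "image_mset f (mset_set A) = image_mset g (mset_set B)"
    using h(1) by (simp add: bij_betw_def image_mset_mset_set)
qed

lemma wl_Suc_eq_iff:
  assumes "finite (univ A)" "finite (univ B)"
  shows "wl \<sigma> m A (Suc r) v = wl \<sigma> m B (Suc r) w \<longleftrightarrow> wl \<sigma> m A r v = wl \<sigma> m B r w \<and>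
    (\<exists>h. bij_betw h (univ A) (univ B) \<and>
      (\<forall>x\<in>univ A. \<forall>i<m. wl \<sigma> m A r (v[i := x]) = wl \<sigma> m B r (w[i := h x])))"
  using assms by (simp add: wl_refine_def image_mset_mset_set_eq_iff atLeast0LessThan Ball_def)

lemma wl_eq_imp_atp_eq: "wl \<sigma> m A r v = wl \<sigma> m B r w \<Longrightarrow> atp \<sigma> A v = atp \<sigma> B w"
  by (induction r) (auto simp: wl_refine_def)

lemma wl_eq_antimono:
  assumes "r \<le> s" "wl \<sigma> m A s v = wl \<sigma> m B s w"
  shows "wl \<sigma> m A r v = wl \<sigma> m B r w"
  using assms by (induction s rule: dec_induct) (auto simp: wl_refine_def)

lemma finite_tuples: "finite V \<Longrightarrow> finite (tuples V l)"
  using finite_lists_length_eq[of V l] by (simp add: tuples_def conj_commute)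

lemma card_tuples_Suc_filter:
  assumes "finite V"
  shows "card {u \<in> tuples V (Suc l). P u} = (\<Sum>x\<in>V. card {u \<in> tuples V l. P (u @ [x])})"
proof -
  have "{u \<in> tuples V (Suc l). P u} =
      (\<Union>x\<in>V. (\<lambda>u. u @ [x]) ` {u \<in> tuples V l. P (u @ [x])})" (is "?L = ?R")
  proof
    show "?L \<subseteq> ?R"
    proof
      fix u assume u: "u \<in> ?L"
      then have "u \<noteq> []" by (auto simp: tuples_def)
      then obtain u' x where "u = u' @ [x]" by (metis rev_exhaust)
      then show "u \<in> ?R" using u by (auto simp: tuples_def)
    qed
  qed (auto simp: tuples_def)
  also have "card \<dots> = (\<Sum>x\<in>V. card ((\<lambda>u. u @ [x]) ` {u \<in> tuples V l. P (u @ [x])}))"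
    using assms by (intro card_UN_disjoint) (auto simp: finite_tuples)
  also have "\<dots> = (\<Sum>x\<in>V. card {u \<in> tuples V l. P (u @ [x])})"
    by (intro sum.cong refl card_image) (auto simp: inj_on_def)
  finally show ?thesis .
qed

text \<open>The additional rounds replace the first \<open>l\<close> entries one after the other.\<close>

lemma card_wl_color_prefix_eq:
  assumes fin: "finite (univ A)" "finite (univ B)"
    and "wl \<sigma> m A (r + l) v = wl \<sigma> m B (r + l) w" "l \<le> m" "length v = m" "length w = m"
  shows "card {u \<in> tuples (univ A) l. wl \<sigma> m A r (u @ drop l v) = c} =
    card {u \<in> tuples (univ B) l. wl \<sigma> m B r (u @ drop l w) = c}"
  using assms(3-)
proof (induction l arbitrary: v w)
  case 0
  then show ?case
    by (cases "wl \<sigma> m B r w = c") (simp_all add: tuples_def cong: conj_cong)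
next
  case (Suc l)
  let ?N = "\<lambda>C v x. card {u \<in> tuples (univ C) l. wl \<sigma> m C r (u @ x # drop (Suc l) v) = c}"
  obtain h where h: "bij_betw h (univ A) (univ B)"
    and eq: "\<And>x. x \<in> univ A \<Longrightarrow> wl \<sigma> m A (r + l) (v[l := x]) = wl \<sigma> m B (r + l) (w[l := h x])"
    using Suc.prems(1,2) wl_Suc_eq_iff[OF fin, of \<sigma> m "r + l" v w] by auto
  have drop: "drop l (v[l := x]) = x # drop (Suc l) v" if "length v = m" for v :: "'x list" and x
    using that Suc.prems(2) by (simp flip: Cons_nth_drop_Suc)
  have "?N A v x = ?N B w (h x)" if "x \<in> univ A" for x
    using Suc.IH[OF eq[OF that]] Suc.prems by (simp add: drop)
  then have "(\<Sum>x\<in>univ A. ?N A v x) = (\<Sum>x\<in>univ B. ?N B w x)"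
    using sum.reindex_bij_betw[OF h, of "?N B w"] by simp
  then show ?case using fin by (simp add: card_tuples_Suc_filter)
qed

lemma wl_eq_imp_not_distinguishes_after:
  assumes "finite (univ A)" "finite (univ B)" "length v = m" "length w = m"
    and "wl \<sigma> m A (r + m) v = wl \<sigma> m B (r + m) w"
  shows "\<not> wl_distinguishes_after \<sigma> m r A B"
  using card_wl_color_prefix_eq[OF assms(1,2,5) order_refl assms(3,4)] assms(3,4)
  by (simp add: wl_distinguishes_after_def)

lemma not_wl_distinguishes_imp_wl_eq:
  assumes "\<not> wl_distinguishes_after \<sigma> m r A B" "finite (univ A)" "v \<in> tuples (univ A) m"
  shows "\<exists>w\<in>tuples (univ B) m. wl \<sigma> m A r v = wl \<sigma> m B r w"
proof -
  let ?class = "\<lambda>C. {u \<in> tuples (univ C) m. wl \<sigma> m C r u = wl \<sigma> m A r v}"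
  have "card (?class A) \<noteq> 0"
    using assms(2,3) by (subst card_0_eq) (auto simp: finite_tuples)
  then have "card (?class B) \<noteq> 0"
    using assms(1) by (simp add: wl_distinguishes_after_def)
  then have "?class B \<noteq> {}" by force
  then show ?thesis by (auto simp: eq_commute)
qed

lemma wl_eq_overwrite:
  assumes fin: "finite (univ A)" "finite (univ B)" and "I \<subseteq> {..<m}"
    and "wl \<sigma> m A (r + card I) v = wl \<sigma> m B (r + card I) w" "length v = m" "length w = m"
    and v': "v' \<in> tuples (univ A) m" "\<And>i. i \<in> {..<m} - I \<Longrightarrow> v' ! i = v ! i"
  shows "\<exists>w'. length w' = m \<and> wl \<sigma> m A r v' = wl \<sigma> m B r w' \<and> (\<forall>i. i \<notin> I \<longrightarrow> w' ! i = w ! i)"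
  using finite_subset[OF assms(3) finite_lessThan] assms(3-)
proof (induction I arbitrary: v w rule: finite_induct)
  case empty
  then have "v' = v" by (intro nth_equalityI) (auto simp: tuples_def)
  then show ?case using empty by auto
next
  case (insert j I)
  have j: "j < m" using insert.prems by simp
  then have "v' ! j \<in> univ A" using v'(1) by (auto simp: tuples_def)
  then obtain y where "wl \<sigma> m A (r + card I) (v[j := v' ! j]) = wl \<sigma> m B (r + card I) (w[j := y])"
    using insert.prems(2) insert.hyps j wl_Suc_eq_iff[OF fin, of \<sigma> m "r + card I" v w] by auto
  moreover have "v' ! i = v[j := v' ! j] ! i" if "i \<in> {..<m} - I" for i
    using that j insert.prems(3,6) by (cases "i = j") auto
  ultimately obtain w' where "length w' = m" "wl \<sigma> m A r v' = wl \<sigma> m B r w'"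
    "\<forall>i. i \<notin> I \<longrightarrow> w' ! i = w[j := y] ! i"
    using insert.IH[of "v[j := v' ! j]" "w[j := y]"] insert.prems v'(1) by auto
  then show ?case by (intro exI[of _ w']) auto
qed

section \<open>XOR systems and their pebble game\<close>

declare add_bit_eq_xor [simp del] mult_bit_eq_and [simp del]

lemma bit_add_eq_0_iff [simp]: "a + b = 0 \<longleftrightarrow> a = (b::bit)"
  by (cases a; cases b) simp_all

definition xor_vars :: "('v list \<times> bit) set \<Rightarrow> 'v set" where
  "xor_vars C = (\<Union>(xs, b)\<in>C. set xs)"

definition consistent :: "('v list \<times> bit) set \<Rightarrow> 'v set \<Rightarrow> ('v \<Rightarrow> bit) \<Rightarrow> bool" where
  "consistent C X \<alpha> \<longleftrightarrow> (\<forall>(xs, b)\<in>C. set xs \<subseteq> X \<longrightarrow> (\<Sum>x\<leftarrow>xs. \<alpha> x) = b)"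

text \<open>In each round Spoiler keeps at most \<open>p\<close> of the assigned variables and asks for the values of at
  most \<open>q\<close> further ones.\<close>

primrec duplicator_wins ::
    "('v list \<times> bit) set \<Rightarrow> nat \<Rightarrow> nat \<Rightarrow> nat \<Rightarrow> 'v set \<Rightarrow> ('v \<Rightarrow> bit) \<Rightarrow> bool" where
  "duplicator_wins C p q 0 X \<alpha> \<longleftrightarrow> consistent C X \<alpha>"
| "duplicator_wins C p q (Suc r) X \<alpha> \<longleftrightarrow> consistent C X \<alpha> \<and>
     (\<forall>X' Y. X' \<subseteq> X \<longrightarrow> finite X' \<longrightarrow> card X' \<le> p \<longrightarrow> finite Y \<longrightarrow> card Y \<le> q \<longrightarrow>
       (\<exists>\<alpha>'. (\<forall>x\<in>X'. \<alpha>' x = \<alpha> x) \<and> duplicator_wins C p q r (X' \<union> Y) \<alpha>'))"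

lemma duplicator_wins_imp_consistent: "duplicator_wins C p q r X \<alpha> \<Longrightarrow> consistent C X \<alpha>"
  by (cases r) auto

lemma duplicator_wins_respond:
  assumes "duplicator_wins C p q (Suc r) X \<alpha>" "X' \<subseteq> X" "finite X'" "card X' \<le> p"
    "finite Y" "card Y \<le> q"
  shows "\<exists>\<alpha>'. (\<forall>x\<in>X'. \<alpha>' x = \<alpha> x) \<and> duplicator_wins C p q r (X' \<union> Y) \<alpha>'"
  using assms unfolding duplicator_wins.simps by blast

lemma duplicator_wins_if_invariant:
  assumes "\<And>r X \<alpha>. Inv r X \<alpha> \<Longrightarrow> consistent C X \<alpha>"
    and "\<And>r X \<alpha> X' Y. Inv (Suc r) X \<alpha> \<Longrightarrow> X' \<subseteq> X \<Longrightarrow> finite X' \<Longrightarrow> card X' \<le> p \<Longrightarrow>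
      finite Y \<Longrightarrow> card Y \<le> q \<Longrightarrow> \<exists>\<alpha>'. (\<forall>x\<in>X'. \<alpha>' x = \<alpha> x) \<and> Inv r (X' \<union> Y) \<alpha>'"
    and "Inv r X \<alpha>"
  shows "duplicator_wins C p q r X \<alpha>"
  using assms(3)
proof (induction r arbitrary: X \<alpha>)
  case 0
  then show ?case using assms(1) by simp
next
  case (Suc r)
  show ?case
    using assms(1)[OF Suc.prems] assms(2)[OF Suc.prems] Suc.IH
    unfolding duplicator_wins.simps by blast
qed

lemma consistent_mono:
  assumes "consistent C X \<alpha>" "X' \<subseteq> X" "\<And>x. x \<in> X' \<Longrightarrow> \<alpha>' x = \<alpha> x"
  shows "consistent C X' \<alpha>'"
proof -
  have "(\<Sum>x\<leftarrow>xs. \<alpha>' x) = (\<Sum>x\<leftarrow>xs. \<alpha> x)" if "set xs \<subseteq> X'" for xs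
    using assms(3) that by (intro arg_cong[where f = sum_list] map_cong) auto
  then show ?thesis using assms(1,2) unfolding consistent_def by fastforce
qed

lemma duplicator_wins_mono:
  assumes "duplicator_wins C p q s X \<alpha>" "r \<le> s" "X' \<subseteq> X" "\<And>x. x \<in> X' \<Longrightarrow> \<alpha>' x = \<alpha> x"
  shows "duplicator_wins C p q r X' \<alpha>'"
proof (rule duplicator_wins_if_invariant)
  let ?Inv = "\<lambda>r X' \<alpha>'. \<exists>s X \<alpha>. duplicator_wins C p q s X \<alpha> \<and> r \<le> s \<and> X' \<subseteq> X \<and>
    (\<forall>x\<in>X'. \<alpha>' x = \<alpha> x)"
  show "consistent C X' \<alpha>'" if "?Inv r X' \<alpha>'" for r X' \<alpha>'
    using that consistent_mono duplicator_wins_imp_consistent by metis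
  show "\<exists>\<beta>. (\<forall>x\<in>Z. \<beta> x = \<alpha>' x) \<and> ?Inv r (Z \<union> Y) \<beta>"
    if Inv: "?Inv (Suc r) X' \<alpha>'" and Z: "Z \<subseteq> X'" "finite Z" "card Z \<le> p"
      and Y: "finite Y" "card Y \<le> q" for r X' \<alpha>' Z Y
  proof -
    obtain s X \<alpha> where s: "duplicator_wins C p q (Suc s) X \<alpha>" "r \<le> s"
      and X: "X' \<subseteq> X" "\<And>x. x \<in> X' \<Longrightarrow> \<alpha>' x = \<alpha> x"
      using Inv by (metis Suc_le_D Suc_le_mono)
    obtain \<beta> where "\<forall>x\<in>Z. \<beta> x = \<alpha> x" "duplicator_wins C p q s (Z \<union> Y) \<beta>"
      using duplicator_wins_respond[OF s(1) order_trans[OF Z(1) X(1)] Z(2,3) Y] by blast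
    then show ?thesis using s(2) X(2) Z(1) by (intro exI[of _ \<beta>]) auto
  qed
  show "?Inv r X' \<alpha>'" using assms by blast
qed

section \<open>XOR structures\<close>

definition xor_sig :: "(nat list \<times> bit) list \<Rightarrow> signature" where
  "xor_sig cs = map (\<lambda>c. length (fst c)) cs"

text \<open>Element \<open>e\<close> stands for the variable \<open>e div 2\<close> with value \<open>e mod 2\<close>; if \<open>n\<close> is odd, the last
  element is padding. Each constraint \<open>(L, b)\<close> is one relation, which requires the sum over \<open>L\<close> to be
  \<open>0\<close> in the untwisted and \<open>b\<close> in the twisted structure.\<close>

definition xor_struct :: "nat \<Rightarrow> (nat list \<times> bit) list \<Rightarrow> bool \<Rightarrow> nat rel_struct" where
  "xor_struct n cs tw = \<lparr>univ = {..<n}, rel = (\<lambda>i.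
     {es. set es \<subseteq> {..<n} \<and> map (\<lambda>e. e div 2) es = fst (cs ! i) \<and>
          (\<Sum>e\<leftarrow>es. of_nat e) = (if tw then snd (cs ! i) else 0)})\<rparr>"

lemma univ_xor_struct [simp]: "univ (xor_struct n cs tw) = {..<n}"
  by (simp add: xor_struct_def)

lemma kary_structure_xor_struct:
  assumes "\<And>L b. (L, b) \<in> set cs \<Longrightarrow> length L \<le> k"
  shows "kary_structure k (xor_sig cs) (xor_struct n cs tw)"
proof -
  have "rel (xor_struct n cs tw) i \<subseteq> tuples {..<n} (xor_sig cs ! i)"
    if "i < length (xor_sig cs)" for i
    using that
    by (auto simp: xor_struct_def xor_sig_def tuples_def dest: arg_cong[where f = length])
  then show ?thesis using assms
    by (auto simp: kary_structure_def relational_structure_def xor_sig_def)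
qed

definition flip :: "nat \<Rightarrow> (nat \<Rightarrow> bit) \<Rightarrow> nat \<Rightarrow> nat" where
  "flip n \<eta> e =
     (if e div 2 < n div 2 \<and> \<eta> (e div 2) = 1 then (if even e then e + 1 else e - 1) else e)"

lemma flip_div2 [simp]: "flip n \<eta> e div 2 = e div 2"
  by (auto simp: flip_def elim!: evenE oddE)

lemma flip_flip [simp]: "flip n \<eta> (flip n \<eta> e) = e"
  by (auto simp: flip_def elim!: evenE oddE)

lemma flip_less_iff [simp]: "flip n \<eta> e < n \<longleftrightarrow> e < n"
  by (auto simp: flip_def elim!: evenE oddE)

lemma of_nat_flip: "e div 2 < n div 2 \<Longrightarrow> (of_nat (flip n \<eta> e) :: bit) = of_nat e + \<eta> (e div 2)"
  by (cases "\<eta> (e div 2)") (auto simp: flip_def elim!: evenE oddE)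

lemma flip_eq_iff [simp]: "flip n \<eta> e = flip n \<eta> e' \<longleftrightarrow> e = e'"
  by (metis flip_flip)

lemma flip_cong: "\<eta> (e div 2) = \<eta>' (e div 2) \<Longrightarrow> flip n \<eta> e = flip n \<eta>' e"
  by (simp add: flip_def)

definition pebbled :: "nat list \<Rightarrow> nat set" where
  "pebbled v = (\<lambda>e. e div 2) ` set v"

lemma finite_pebbled [simp]: "finite (pebbled v)"
  by (simp add: pebbled_def)

lemma card_pebbled_le: "card (pebbled v) \<le> length v"
  unfolding pebbled_def by (meson card_image_le card_length finite_set le_trans)

lemma pebbled_mono: "set u \<subseteq> set v \<Longrightarrow> pebbled u \<subseteq> pebbled v"
  by (auto simp: pebbled_def)

lemma pebbled_update_subset: "pebbled (v[i := x]) \<subseteq> pebbled v \<union> {x div 2}"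
  using set_update_subset_insert[of v i x] by (auto simp: pebbled_def)

lemma map_flip_in_rel_iff:
  assumes vars: "xor_vars (set cs) \<subseteq> {..<n div 2}" and \<eta>: "consistent (set cs) (pebbled es) \<eta>"
    and s: "s < length cs"
  shows "map (flip n \<eta>) es \<in> rel (xor_struct n cs True) s \<longleftrightarrow> es \<in> rel (xor_struct n cs False) s"
proof -
  obtain L b where nth_cs: "cs ! s = (L, b)" by (cases "cs ! s")
  then have mem: "(L, b) \<in> set cs" using s by (metis nth_mem)
  have sum: "(\<Sum>e\<leftarrow>map (flip n \<eta>) es. of_nat e) = (\<Sum>e\<leftarrow>es. of_nat e) + b"
    if L: "map (\<lambda>e. e div 2) es = L"
  proof -
    have set_L: "set L = pebbled es" unfolding L[symmetric] pebbled_def by simp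
    then have "pebbled es \<subseteq> {..<n div 2}" using vars mem by (auto simp: xor_vars_def)
    then have "(\<Sum>e\<leftarrow>map (flip n \<eta>) es. of_nat e) = (\<Sum>e\<leftarrow>es. of_nat e + \<eta> (e div 2))"
      by (auto simp: of_nat_flip pebbled_def image_subset_iff intro!: arg_cong[where f = sum_list])
    also have "\<dots> = (\<Sum>e\<leftarrow>es. of_nat e) + (\<Sum>y\<leftarrow>map (\<lambda>e. e div 2) es. \<eta> y)"
      by (simp add: sum_list_addf o_def)
    also have "(\<Sum>y\<leftarrow>map (\<lambda>e. e div 2) es. \<eta> y) = b"
      using \<eta> mem set_L unfolding L consistent_def by auto
    finally show ?thesis .
  qed
  have "map (\<lambda>e. e div 2) (map (flip n \<eta>) es) = map (\<lambda>e. e div 2) es" by simp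
  moreover have "set (map (flip n \<eta>) es) \<subseteq> {..<n} \<longleftrightarrow> set es \<subseteq> {..<n}" by auto
  ultimately show ?thesis
    using sum nth_cs by (simp add: xor_struct_def del: map_map set_map cong: conj_cong)
qed

lemma atp_map_flip:
  assumes "xor_vars (set cs) \<subseteq> {..<n div 2}" "consistent (set cs) (pebbled v) \<eta>"
  shows "atp (xor_sig cs) (xor_struct n cs False) v =
    atp (xor_sig cs) (xor_struct n cs True) (map (flip n \<eta>) v)"
proof -
  have "map ((!) (map (flip n \<eta>) v)) js \<in> rel (xor_struct n cs True) s \<longleftrightarrow>
      map ((!) v) js \<in> rel (xor_struct n cs False) s"
    if s: "s < length cs" and js: "js \<in> tuples {..<length v} (xor_sig cs ! s)" for s js
  proof -
    have "set (map ((!) v) js) \<subseteq> set v" using js by (auto simp: tuples_def)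
    then have "consistent (set cs) (pebbled (map ((!) v) js)) \<eta>"
      by (rule consistent_mono[OF assms(2) pebbled_mono]) simp
    moreover have "map ((!) (map (flip n \<eta>) v)) js = map (flip n \<eta>) (map ((!) v) js)"
      using js by (auto simp: tuples_def)
    ultimately show ?thesis using map_flip_in_rel_iff[OF assms(1) _ s] by metis
  qed
  then show ?thesis
    unfolding atp_def by (auto simp: xor_sig_def simp del: map_map cong: conj_cong)
qed

lemma wl_map_flip:
  assumes vars: "xor_vars (set cs) \<subseteq> {..<n div 2}"
    and "duplicator_wins (set cs) d 1 r (pebbled v) \<eta>" "length v = d"
  shows "wl (xor_sig cs) d (xor_struct n cs False) r v =
    wl (xor_sig cs) d (xor_struct n cs True) r (map (flip n \<eta>) v)"
  using assms(2,3)
proof (induction r arbitrary: v \<eta>)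
  case 0
  then show ?case using atp_map_flip[OF vars] by simp
next
  case (Suc r)
  let ?wl = "\<lambda>tw. wl (xor_sig cs) d (xor_struct n cs tw)" and ?w = "map (flip n \<eta>) v"
  have "\<exists>\<eta>'. (\<forall>z\<in>pebbled v. \<eta>' z = \<eta> z) \<and>
      duplicator_wins (set cs) d 1 r (pebbled v \<union> {y}) \<eta>'" for y
    using duplicator_wins_respond[OF Suc.prems(1), of "pebbled v" "{y}"]
      card_pebbled_le[of v] Suc.prems(2) by auto
  then obtain respond where respond: "\<And>y z. z \<in> pebbled v \<Longrightarrow> respond y z = \<eta> z"
    "\<And>y. duplicator_wins (set cs) d 1 r (pebbled v \<union> {y}) (respond y)"
    by metis
  define h where "h x = flip n (respond (x div 2)) x" for x
  have "bij_betw h {..<n} {..<n}"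
    unfolding h_def by (rule bij_betw_byWitness[where f' = "\<lambda>x. flip n (respond (x div 2)) x"]) auto
  moreover have "?wl False r (v[i := x]) = ?wl True r (?w[i := h x])" for i x
  proof -
    have "duplicator_wins (set cs) d 1 r (pebbled (v[i := x])) (respond (x div 2))"
      using respond(2) pebbled_update_subset by (rule duplicator_wins_mono[OF _ order_refl]) simp
    then have "?wl False r (v[i := x]) = ?wl True r (map (flip n (respond (x div 2))) (v[i := x]))"
      using Suc.prems(2) by (intro Suc.IH) simp_all
    moreover have "map (flip n (respond y)) v = ?w" for y
      using respond(1) by (auto simp: pebbled_def intro!: flip_cong)
    ultimately show ?thesis by (simp add: map_update h_def)
  qed
  moreover have "?wl False r v = ?wl True r ?w"
    using duplicator_wins_mono[OF Suc.prems(1)] Suc.prems(2) by (intro Suc.IH) simp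
  ultimately show ?case by (subst wl_Suc_eq_iff) auto
qed

proposition not_wl_distinguishes_after_xor_struct:
  assumes vars: "xor_vars (set cs) \<subseteq> {..<n div 2}"
    and wins: "duplicator_wins (set cs) d 1 (Suc (r + d)) {} \<eta>"
  shows "\<not> wl_distinguishes_after (xor_sig cs) d r (xor_struct n cs False) (xor_struct n cs True)"
proof -
  let ?v = "replicate d (0::nat)"
  obtain \<eta>' where "duplicator_wins (set cs) d 1 (r + d) {0} \<eta>'"
    using duplicator_wins_respond[OF wins, of "{}" "{0}"] by auto
  then have "duplicator_wins (set cs) d 1 (r + d) (pebbled ?v) \<eta>'"
    by (rule duplicator_wins_mono) (auto simp: pebbled_def)
  from wl_map_flip[OF vars this]
  show ?thesis by (intro wl_eq_imp_not_distinguishes_after) auto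
qed

section \<open>Spoiler's strategy on condensed systems\<close>

text \<open>\<open>nb x 0, \<dots>, nb x (\<Delta> - 1)\<close> are the neighbours of \<open>x\<close> in a bipartite multigraph; repeated
  neighbours cancel.\<close>

definition nbhd :: "('v \<Rightarrow> nat \<Rightarrow> 'y) \<Rightarrow> nat \<Rightarrow> 'v set \<Rightarrow> 'y set" where
  "nbhd nb \<Delta> S = (\<lambda>(x, i). nb x i) ` (S \<times> {..<\<Delta>})"

definition condense :: "('v \<Rightarrow> nat \<Rightarrow> 'y) \<Rightarrow> nat \<Rightarrow> 'v list \<times> bit \<Rightarrow> 'y list \<times> bit" where
  "condense nb \<Delta> = (\<lambda>(xs, b). (concat (map (\<lambda>x. map (nb x) [0..<\<Delta>]) xs), b))"

lemma xor_vars_condense: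
  "xor_vars (condense nb \<Delta> ` C) = nbhd nb \<Delta> (xor_vars C)"
  by (force simp: xor_vars_def condense_def nbhd_def)

lemma length_condense: "length (fst (condense nb \<Delta> c)) = length (fst c) * \<Delta>"
proof -
  obtain xs b where "c = (xs, b)" by fastforce
  moreover have "length (concat (map (\<lambda>x. map (nb x) [0..<\<Delta>]) xs)) = length xs * \<Delta>"
    by (induction xs) auto
  ultimately show ?thesis by (simp add: condense_def)
qed

lemma atp_eq_imp_constraint:
  assumes atp: "atp (xor_sig cs) (xor_struct n cs False) v =
      atp (xor_sig cs) (xor_struct n cs True) w"
    and L: "(L, b) \<in> set cs" "set L \<subseteq> {..<n div 2}"
    and js: "map ((!) v) js = map ((*) 2) L" "set js \<subseteq> {..<length v}"
  shows "(\<Sum>j\<leftarrow>js. of_nat (w ! j)) = b"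
proof -
  obtain s where s: "s < length cs" "cs ! s = (L, b)" using L by (auto simp: in_set_conv_nth)
  let ?T = "\<lambda>C v. {js \<in> tuples {..<length v} (xor_sig cs ! s). map ((!) v) js \<in> rel C s}"
  have "?T (xor_struct n cs False) v = ?T (xor_struct n cs True) w"
    using atp s(1) by (simp add: atp_def xor_sig_def)
  moreover have "js \<in> ?T (xor_struct n cs False) v"
  proof -
    have "length js = length L" using arg_cong[OF js(1), of length] by simp
    moreover have "map (\<lambda>e. e div 2) (map ((!) v) js) = L" unfolding js(1) by (simp add: o_def)
    moreover have "(\<Sum>e\<leftarrow>map ((*) 2) L. of_nat e) = (0::bit)"
      by (induction L) auto
    moreover have "set (map ((*) 2) L) \<subseteq> {..<n}" using L(2) by auto
    ultimately show ?thesis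
      using js s by (simp add: tuples_def xor_sig_def xor_struct_def del: set_map map_map)
  qed
  ultimately have "map ((!) w) js \<in> rel (xor_struct n cs True) s" by blast
  then show ?thesis using s by (simp add: xor_struct_def o_def)
qed

lemma slot_assignment_exists:
  fixes q P :: nat
  assumes "q < P" "length ys < P"
  shows "\<exists>p qs. map p (q # qs) = x # ys \<and> set qs \<subseteq> {..<P} \<and> (\<forall>s. p s \<in> set (x # ys))"
proof -
  define place where "place = transpose 0 q"
  define p where "p s = (if place s \<le> length ys then (x # ys) ! place s else x)" for s
  have "map p (map place [0..<Suc (length ys)]) = x # ys"
    by (rule nth_equalityI) (auto simp: p_def place_def simp del: upt_Suc)
  moreover have "map place [0..<Suc (length ys)] = q # map place [1..<Suc (length ys)]"
    unfolding upt_conv_Cons[OF zero_less_Suc] by (simp add: place_def)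
  moreover have "set (map place [1..<Suc (length ys)]) \<subseteq> {..<P}"
    using assms by (auto simp: place_def transpose_def)
  moreover have "p s \<in> set (x # ys)" for s
    using nth_mem[of "place s" "x # ys"] by (auto simp: p_def)
  ultimately show ?thesis by metis
qed

text \<open>The constraints derive the value \<open>0\<close> for all variables in order of increasing rank, which
  contradicts the constraint on the sink. Spoiler keeps up to \<open>P\<close> variables on the board, each in
  its own slot of \<open>\<Delta>\<close> positions. A variable of wrong parity has an input of wrong parity, so the
  error moves down until it disappears.\<close>

locale spoiler =
  fixes V :: "'v set" and rank :: "'v \<Rightarrow> nat" and sink :: 'v and C :: "('v list \<times> bit) set"
    and nb :: "'v \<Rightarrow> nat \<Rightarrow> nat" and n k \<Delta> P :: nat and cs :: "(nat list \<times> bit) list"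
  assumes inputs: "\<And>x. x \<in> V \<Longrightarrow> \<exists>ys. (x # ys, 0) \<in> C \<and> length ys < P \<and>
      set ys \<subseteq> V \<and> (\<forall>y\<in>set ys. rank y < rank x)"
    and sink: "sink \<in> V" "([sink], 1) \<in> C"
    and nb_less: "\<And>x i. x \<in> V \<Longrightarrow> i < \<Delta> \<Longrightarrow> nb x i < n div 2"
    and condense_cs: "condense nb \<Delta> ` C \<subseteq> set cs"
    and slots_le: "P * \<Delta> \<le> k" and n_pos: "0 < n"
begin

abbreviation "A \<equiv> xor_struct n cs False"
abbreviation "B \<equiv> xor_struct n cs True"
abbreviation "\<sigma> \<equiv> xor_sig cs"

definition board :: "(nat \<Rightarrow> 'v) \<Rightarrow> nat list" where
  "board p = map (\<lambda>i. if i < P * \<Delta> then 2 * nb (p (i div \<Delta>)) (i mod \<Delta>) else 0) [0..<k]"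

definition slot :: "nat \<Rightarrow> nat list" where
  "slot q = [q * \<Delta>..<q * \<Delta> + \<Delta>]"

definition slot_parity :: "nat list \<Rightarrow> nat \<Rightarrow> bit" where
  "slot_parity w q = (\<Sum>j\<leftarrow>slot q. of_nat (w ! j))"

lemma length_board [simp]: "length (board p) = k"
  by (simp add: board_def)

lemma slot_subset:
  assumes "q < P"
  shows "set (slot q) \<subseteq> {..<P * \<Delta>}"
proof -
  have "(q + 1) * \<Delta> \<le> P * \<Delta>" using assms by (intro mult_right_mono) auto
  then show ?thesis by (auto simp: slot_def)
qed

lemma map_board_slot:
  assumes "q < P"
  shows "map ((!) (board p)) (slot q) = map (\<lambda>i. 2 * nb (p q) i) [0..<\<Delta>]"
proof (rule nth_equalityI)
  fix i assume "i < length (map ((!) (board p)) (slot q))"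
  then have i: "i < \<Delta>" by (simp add: slot_def)
  then have "q * \<Delta> + i \<in> set (slot q)" by (simp add: slot_def)
  then have "q * \<Delta> + i < P * \<Delta>" using slot_subset[OF assms] by blast
  then show "map ((!) (board p)) (slot q) ! i = map (\<lambda>i. 2 * nb (p q) i) [0..<\<Delta>] ! i"
    using i slots_le by (simp add: slot_def board_def)
qed (simp add: slot_def)

lemma board_in_tuples:
  assumes "\<And>q. q < P \<Longrightarrow> p q \<in> V"
  shows "board p \<in> tuples (univ A) k"
proof -
  have "2 * nb (p (i div \<Delta>)) (i mod \<Delta>) < n" if i: "i < P * \<Delta>" for i
  proof -
    have "0 < \<Delta>" using i by (cases \<Delta>) auto
    with i have "i div \<Delta> < P" "i mod \<Delta> < \<Delta>" by (simp_all add: less_mult_imp_div_less)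
    then show ?thesis using nb_less[OF assms, of "i div \<Delta>" "i mod \<Delta>"] by simp
  qed
  then show ?thesis using n_pos by (auto simp: tuples_def board_def)
qed

lemma replace_other_slots:
  assumes eq: "wl \<sigma> k A (r + k) (board p) = wl \<sigma> k B (r + k) w" and len: "length w = k"
    and q: "q < P" "p' q = p q" and p': "\<And>q. q < P \<Longrightarrow> p' q \<in> V"
  obtains w' where "length w' = k" "wl \<sigma> k A r (board p') = wl \<sigma> k B r w'"
    "slot_parity w' q = slot_parity w q"
proof -
  let ?I = "{..<k} - set (slot q)"
  have "r + card ?I \<le> r + k" using card_mono[of "{..<k}" ?I] by auto
  from wl_eq_antimono[OF this eq]
  have "wl \<sigma> k A (r + card ?I) (board p) = wl \<sigma> k B (r + card ?I) w" .
  moreover have "board p' ! j = board p ! j" if "j \<in> {..<k} - ?I" for j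
  proof -
    have "map ((!) (board p')) (slot q) = map ((!) (board p)) (slot q)"
      unfolding map_board_slot[OF q(1)] q(2) ..
    then show ?thesis using that by simp
  qed
  ultimately obtain w' where w': "length w' = k" "wl \<sigma> k A r (board p') = wl \<sigma> k B r w'"
    "\<And>j. j \<notin> ?I \<Longrightarrow> w' ! j = w ! j"
    using wl_eq_overwrite[of A B ?I k \<sigma> r "board p" w "board p'"] board_in_tuples[OF p'] len by auto
  moreover have "slot_parity w' q = slot_parity w q"
    unfolding slot_parity_def using w'(3) by (intro arg_cong[where f = sum_list] map_cong) auto
  ultimately show thesis using that by blast
qed

lemma sum_slot_parity:
  assumes eq: "wl \<sigma> k A r (board p) = wl \<sigma> k B r w"
    and constraint: "(map p qs, b) \<in> C" and qs: "set qs \<subseteq> {..<P}" "p ` set qs \<subseteq> V"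
  shows "(\<Sum>q\<leftarrow>qs. slot_parity w q) = b"
proof -
  let ?js = "concat (map slot qs)" and ?L = "concat (map (\<lambda>q. map (nb (p q)) [0..<\<Delta>]) qs)"
  have "condense nb \<Delta> (map p qs, b) \<in> set cs" using constraint condense_cs by blast
  then have "(?L, b) \<in> set cs" by (simp add: condense_def o_def)
  moreover have "set ?L \<subseteq> {..<n div 2}" using qs(2) nb_less by auto
  moreover have "map ((!) (board p)) ?js = map ((*) 2) ?L"
    using qs(1) by (induction qs) (auto simp: map_board_slot)
  moreover have "set ?js \<subseteq> {..<length (board p)}"
    using qs(1) slot_subset slots_le by fastforce
  ultimately have "(\<Sum>j\<leftarrow>?js. of_nat (w ! j)) = b"
    by (rule atp_eq_imp_constraint[OF wl_eq_imp_atp_eq[OF eq]])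
  moreover have "(\<Sum>j\<leftarrow>?js. of_nat (w ! j)) = (\<Sum>q\<leftarrow>qs. slot_parity w q)"
    by (induction qs) (auto simp: slot_parity_def)
  ultimately show ?thesis by simp
qed

lemma wrong_parity_imp_wl_neq:
  assumes "Suc (rank (p q)) * k \<le> r" "q < P" "p q \<in> V" "slot_parity w q = 1" "length w = k"
  shows "wl \<sigma> k A r (board p) \<noteq> wl \<sigma> k B r w"
  using assms
proof (induction "rank (p q)" arbitrary: p q w r rule: less_induct)
  case less
  show ?case
  proof
    assume eq: "wl \<sigma> k A r (board p) = wl \<sigma> k B r w"
    obtain ys where ys: "(p q # ys, 0) \<in> C" "length ys < P" "set ys \<subseteq> V"
      "\<And>y. y \<in> set ys \<Longrightarrow> rank y < rank (p q)"
      using inputs[OF less.prems(3)] by blast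
    obtain p' qs where p': "map p' (q # qs) = p q # ys" "\<And>s. p' s \<in> set (p q # ys)"
      and qs: "set qs \<subseteq> {..<P}"
      using slot_assignment_exists[OF less.prems(2) ys(2)] by metis
    have p'_V: "p' s \<in> V" for s using p'(2)[of s] ys(3) less.prems(3) by auto
    obtain r' where r': "r = r' + k" "rank (p q) * k \<le> r'"
      using less.prems(1) by (auto simp: le_iff_add algebra_simps)
    have "p' q = p q" using p'(1) by simp
    then obtain w' where w': "length w' = k" "wl \<sigma> k A r' (board p') = wl \<sigma> k B r' w'"
      "slot_parity w' q = 1"
      using replace_other_slots[OF eq[unfolded r'(1)] less.prems(5,2), of p'] p'_V less.prems(4)
      by auto
    have "slot_parity w' s = 0" if s: "s \<in> set qs" for s
    proof (rule ccontr)
      assume "slot_parity w' s \<noteq> 0"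
      moreover have rank: "rank (p' s) < rank (p q)" using s p'(1) by (intro ys(4)) auto
      moreover have "Suc (rank (p' s)) * k \<le> r'"
        using rank mult_right_mono[of "Suc (rank (p' s))" "rank (p q)" k] r'(2) by simp
      ultimately have "wl \<sigma> k A r' (board p') \<noteq> wl \<sigma> k B r' w'"
        using less.hyps[of p' s r' w'] p'_V w'(1) s qs by auto
      with w'(2) show False by contradiction
    qed
    then have "(\<Sum>s\<leftarrow>qs. slot_parity w' s) = (\<Sum>s\<leftarrow>qs. 0)"
      by (intro arg_cong[where f = sum_list] map_cong) auto
    moreover have "(\<Sum>s\<leftarrow>q # qs. slot_parity w' s) = 0"
      using ys(1) p'(1) p'_V qs less.prems(2,3) by (intro sum_slot_parity[OF w'(2)]) auto
    ultimately show False using w'(3) by simp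
  qed
qed

proposition wl_distinguishes_xor_struct: "wl_distinguishes \<sigma> k A B"
proof (rule ccontr)
  assume not_distinguished: "\<not> ?thesis"
  let ?r = "Suc (rank sink) * k" and ?v = "board (\<lambda>_. sink)"
  have "?v \<in> tuples (univ A) k" using sink(1) by (rule board_in_tuples)
  then obtain w where w: "w \<in> tuples (univ B) k" "wl \<sigma> k A ?r ?v = wl \<sigma> k B ?r w"
    using not_wl_distinguishes_imp_wl_eq[of \<sigma> k ?r A B ?v] not_distinguished
    by (auto simp: wl_distinguishes_def)
  have P: "0 < P" using inputs[OF sink(1)] by auto
  then have "slot_parity w 0 = 1"
    using sum_slot_parity[OF w(2), of "[0]" 1] sink by simp
  then show False
    using wrong_parity_imp_wl_neq[of "\<lambda>_. sink" 0 ?r w] P sink(1) w by (simp add: tuples_def)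
qed

end

section \<open>Expanders\<close>

definition expander :: "'v set \<Rightarrow> ('v \<Rightarrow> nat \<Rightarrow> 'y) \<Rightarrow> nat \<Rightarrow> nat \<Rightarrow> nat \<Rightarrow> bool" where
  "expander V nb \<Delta> \<beta> t \<longleftrightarrow>
     (\<forall>S\<subseteq>V. S \<noteq> {} \<longrightarrow> \<beta> * card S \<le> t \<longrightarrow> \<beta> * card S < card (nbhd nb \<Delta> S))"

lemma card_PiE_if:
  assumes "finite U" "E \<subseteq> U"
  shows "card (\<Pi>\<^sub>E u\<in>U. if u \<in> E then T else H) = card T ^ card E * card H ^ (card U - card E)"
proof -
  have "card (\<Pi>\<^sub>E u\<in>U. if u \<in> E then T else H) = (\<Prod>u\<in>U. if u \<in> E then card T else card H)"
    using assms(1) by (simp add: card_PiE if_distrib[of card] cong: if_cong)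
  also have "\<dots> = card T ^ card (U \<inter> E) * card H ^ card (U - E)"
    using assms(1) by (simp add: prod.If_cases Diff_eq)
  finally show ?thesis
    using assms by (simp add: Int_absorb1 card_Diff_subset finite_subset)
qed

lemma card_PiE_small_image_le:
  assumes fin: "finite U" "finite H" "H \<noteq> {}" and EU: "E \<subseteq> U"
  shows "card {f \<in> U \<rightarrow>\<^sub>E H. card (f ` E) \<le> t} \<le>
    card H ^ t * t ^ card E * card H ^ (card U - card E)"
    (is "card ?small \<le> _")
proof (cases "t \<le> card H")
  case True
  let ?\<T> = "{T. T \<subseteq> H \<and> card T = t}" and ?F = "\<lambda>T. \<Pi>\<^sub>E u\<in>U. if u \<in> E then T else H"
  have fin\<T>: "finite ?\<T>" using fin by simp
  have "finite (?F T)" if "T \<in> ?\<T>" for T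
    using that fin(1,2) finite_subset[of T H] by (intro finite_PiE) auto
  then have fin_Un: "finite (\<Union>T\<in>?\<T>. ?F T)" using fin\<T> by (rule finite_UN_I[rotated])
  have "?small \<subseteq> (\<Union>T\<in>?\<T>. ?F T)"
  proof
    fix f assume f: "f \<in> ?small"
    then have "f ` E \<subseteq> H" "card (f ` E) \<le> t" using EU by auto
    then obtain T where T: "f ` E \<subseteq> T" "T \<in> ?\<T>"
      using exists_subset_between[of "f ` E" t H] True fin(2) by blast
    then have "f \<in> ?F T" using f by (auto simp: PiE_iff split: if_splits)
    with T(2) show "f \<in> (\<Union>T\<in>?\<T>. ?F T)" by blast
  qed
  then have "card ?small \<le> card (\<Union>T\<in>?\<T>. ?F T)" by (rule card_mono[OF fin_Un])
  also have "\<dots> \<le> (\<Sum>T\<in>?\<T>. card (?F T))" by (rule card_UN_le[OF fin\<T>])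
  also have "\<dots> = (card H choose t) * (t ^ card E * card H ^ (card U - card E))"
    using n_subsets[OF fin(2), of t] card_PiE_if[OF fin(1) EU, of _ H] by simp
  also have "\<dots> \<le> card H ^ t * (t ^ card E * card H ^ (card U - card E))"
    using True by (intro mult_right_mono binomial_le_pow) auto
  finally show ?thesis by (simp only: mult.assoc)
next
  case False
  have "card ?small \<le> card (U \<rightarrow>\<^sub>E H)" using fin by (intro card_mono finite_PiE) auto
  also have "\<dots> = card H ^ card E * card H ^ (card U - card E)"
    using card_PiE_if[OF fin(1) EU, of H H] by simp
  also have "\<dots> \<le> card H ^ t * t ^ card E * card H ^ (card U - card E)"
  proof (rule mult_right_mono)
    have "1 \<le> card H ^ t" using fin(2,3) by (simp add: one_le_power card_gt_0_iff Suc_le_eq)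
    then have "1 * card H ^ card E \<le> card H ^ t * t ^ card E"
      using False by (intro mult_mono power_mono) auto
    then show "card H ^ card E \<le> card H ^ t * t ^ card E" by simp
  qed simp
  finally show ?thesis .
qed

lemma sum_power_card_Pow:
  fixes x :: "'a :: comm_semiring_1"
  shows "finite V \<Longrightarrow> (\<Sum>S\<in>Pow V. x ^ card S) = (x + 1) ^ card V"
  using prod_add[of V "\<lambda>_. x" "\<lambda>_. 1"] by simp

lemma one_plus_half_inverse_power_less_2:
  fixes N :: nat
  assumes "0 < N"
  shows "(1 / (2 * real N) + 1) ^ N < 2"
proof -
  have "(1 / (2 * real N) + 1) ^ N \<le> exp (1 / (2 * real N)) ^ N"
    by (intro power_mono) (auto simp: exp_ge_add_one_self add.commute)
  also have "\<dots> = exp (1 / 2)" using assms by (simp flip: exp_of_nat_mult)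
  also have "\<dots> \<le> 1 + 1 / 2 + (1 / 2)\<^sup>2" by (rule exp_bound) auto
  also have "\<dots> < (2 :: real)" by (simp add: power2_eq_square)
  finally show ?thesis .
qed

text \<open>A union bound over the nonempty subsets \<open>S\<close> of \<open>V\<close> with weights \<open>(2 |V|)\<^bsup>-|S|\<^esup>\<close>.\<close>

lemma exists_avoiding_subset_events:
  assumes fin: "finite V" "V \<noteq> {}" "finite \<Omega>" "\<Omega> \<noteq> {}"
    and bad: "\<And>S. S \<subseteq> V \<Longrightarrow> S \<noteq> {} \<Longrightarrow>
      Bad S \<subseteq> \<Omega> \<and> card (Bad S) * (2 * card V) ^ card S \<le> card \<Omega>"
  shows "\<exists>f\<in>\<Omega>. \<forall>S\<subseteq>V. S \<noteq> {} \<longrightarrow> f \<notin> Bad S"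
proof -
  let ?\<P> = "Pow V - {{}}" and ?N = "card V"
  have pos: "0 < ?N" "0 < real (card \<Omega>)" using fin by (auto simp: card_gt_0_iff)
  have "real (card (Bad S)) \<le> real (card \<Omega>) * (1 / (2 * real ?N)) ^ card S" if "S \<in> ?\<P>" for S
  proof -
    have "real (card (Bad S) * (2 * ?N) ^ card S) \<le> real (card \<Omega>)"
      using bad[of S] that by (simp only: of_nat_le_iff) blast
    then show ?thesis using pos by (simp add: power_one_over field_simps)
  qed
  then have "(\<Sum>S\<in>?\<P>. real (card (Bad S))) \<le>
      (\<Sum>S\<in>?\<P>. real (card \<Omega>) * (1 / (2 * real ?N)) ^ card S)"
    by (rule sum_mono)
  also have "\<dots> = real (card \<Omega>) * ((1 / (2 * real ?N) + 1) ^ ?N - 1)"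
    using fin(1) by (simp add: sum_diff1 sum_power_card_Pow flip: sum_distrib_left)
  also have "\<dots> < real (card \<Omega>)"
    using one_plus_half_inverse_power_less_2[OF pos(1)] pos(2) by simp
  finally have "(\<Sum>S\<in>?\<P>. card (Bad S)) < card \<Omega>"
    by (simp flip: of_nat_sum)
  then have "card (\<Union>S\<in>?\<P>. Bad S) < card \<Omega>"
    using card_UN_le[of ?\<P> Bad] fin(1) by simp
  moreover have "(\<Union>S\<in>?\<P>. Bad S) \<subseteq> \<Omega>" using bad by blast
  then have "finite (\<Union>S\<in>?\<P>. Bad S)" using fin(3) by (rule finite_subset)
  ultimately have "\<not> \<Omega> \<subseteq> (\<Union>S\<in>?\<P>. Bad S)" using card_mono leD by blast
  then show ?thesis by blast
qed

lemma card_non_expanding_le: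
  fixes V :: "'v set" and \<Delta> \<beta> t h :: nat
  assumes "finite V" "0 < h" and bound: "2 * card V * t ^ \<Delta> * h ^ \<beta> \<le> h ^ \<Delta>"
    and S: "S \<subseteq> V" "\<beta> * card S \<le> t"
  shows "card {f \<in> V \<times> {..<\<Delta>} \<rightarrow>\<^sub>E {..<h}. card (f ` (S \<times> {..<\<Delta>})) \<le> \<beta> * card S} *
    (2 * card V) ^ card S \<le> card (V \<times> {..<\<Delta>} \<rightarrow>\<^sub>E {..<h})"
    (is "card ?bad * _ \<le> _")
proof -
  let ?N = "card V" and ?s = "card S"
  have exponent: "?s * \<Delta> + (?N * \<Delta> - ?s * \<Delta>) = ?N * \<Delta>"
    using card_mono[OF assms(1) S(1)] by simp
  have "card ?bad \<le> h ^ (\<beta> * ?s) * (\<beta> * ?s) ^ (?s * \<Delta>) * h ^ (?N * \<Delta> - ?s * \<Delta>)"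
    using card_PiE_small_image_le[of "V \<times> {..<\<Delta>}" "{..<h}" "S \<times> {..<\<Delta>}" "\<beta> * ?s"] assms(1,2) S
    by (simp add: card_cartesian_product Sigma_mono lessThan_eq_iff[of h 0, simplified])
  also have "\<dots> \<le> h ^ (\<beta> * ?s) * t ^ (?s * \<Delta>) * h ^ (?N * \<Delta> - ?s * \<Delta>)"
    using S(2) by (intro mult_right_mono mult_left_mono power_mono) simp_all
  finally have "card ?bad * (2 * ?N) ^ ?s \<le>
      h ^ (\<beta> * ?s) * t ^ (?s * \<Delta>) * h ^ (?N * \<Delta> - ?s * \<Delta>) * (2 * ?N) ^ ?s"
    by (rule mult_right_mono) simp
  also have "\<dots> = (2 * ?N * t ^ \<Delta> * h ^ \<beta>) ^ ?s * h ^ (?N * \<Delta> - ?s * \<Delta>)"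
    by (simp add: power_mult_distrib mult_ac flip: power_mult)
  also have "\<dots> \<le> (h ^ \<Delta>) ^ ?s * h ^ (?N * \<Delta> - ?s * \<Delta>)"
    using bound by (intro mult_right_mono power_mono) auto
  also have "\<dots> = h ^ (?N * \<Delta>)"
    unfolding power_mult[symmetric] power_add[symmetric] using exponent by (simp add: mult.commute)
  finally show ?thesis using assms(1) by (simp add: card_PiE card_cartesian_product)
qed

proposition expander_exists:
  fixes V :: "'v set" and \<Delta> \<beta> t h :: nat
  assumes V: "finite V" "V \<noteq> {}" and h: "0 < h"
    and bound: "2 * card V * t ^ \<Delta> * h ^ \<beta> \<le> h ^ \<Delta>"
  shows "\<exists>nb :: 'v \<Rightarrow> nat \<Rightarrow> nat. (\<forall>x\<in>V. \<forall>i<\<Delta>. nb x i < h) \<and> expander V nb \<Delta> \<beta> t"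
proof -
  let ?\<Omega> = "V \<times> {..<\<Delta>} \<rightarrow>\<^sub>E {..<h}"
  define Bad where
    "Bad S = {f \<in> ?\<Omega>. \<beta> * card S \<le> t \<and> card (f ` (S \<times> {..<\<Delta>})) \<le> \<beta> * card S}" for S
  have "card (Bad S) * (2 * card V) ^ card S \<le> card ?\<Omega>" if S: "S \<subseteq> V" for S
    using card_non_expanding_le[OF V(1) h bound S]
    by (cases "\<beta> * card S \<le> t") (simp_all add: Bad_def)
  moreover have "?\<Omega> \<noteq> {}" using h by (auto simp: PiE_eq_empty_iff)
  moreover have "finite ?\<Omega>" using V(1) by (intro finite_PiE) auto
  ultimately obtain f where f: "f \<in> ?\<Omega>" "\<And>S. S \<subseteq> V \<Longrightarrow> S \<noteq> {} \<Longrightarrow> f \<notin> Bad S"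
    using exists_avoiding_subset_events[OF V, of ?\<Omega> Bad] by (auto simp: Bad_def)
  have "\<beta> * card S < card (nbhd (\<lambda>x i. f (x, i)) \<Delta> S)"
    if S: "S \<subseteq> V" "S \<noteq> {}" "\<beta> * card S \<le> t" for S
    using f(1) f(2)[OF S(1,2)] S(3) by (simp add: Bad_def nbhd_def not_le)
  then have "expander V (\<lambda>x i. f (x, i)) \<Delta> \<beta> t" unfolding expander_def by blast
  moreover have "\<forall>x\<in>V. \<forall>i<\<Delta>. f (x, i) < h" using PiE_mem[OF f(1)] by fastforce
  ultimately show ?thesis by (intro exI[of _ "\<lambda>x i. f (x, i)"] conjI)
qed

section \<open>Hardness condensation\<close>

lemma unique_value_exists:
  assumes fin: "finite E" and card: "card E < 2 * card (f ` E - F)"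
  shows "\<exists>e\<in>E. f e \<notin> F \<and> (\<forall>e'\<in>E. f e' = f e \<longrightarrow> e' = e)"
proof (rule ccontr)
  assume none: "\<not> ?thesis"
  let ?fib = "\<lambda>y. {e \<in> E. f e = y}"
  have fibre_ge_2: "2 \<le> card (?fib y)" if y: "y \<in> f ` E - F" for y
  proof -
    obtain e where e: "e \<in> E" "f e = y" "y \<notin> F" using y by auto
    then obtain e' where e': "e' \<in> E" "f e' = f e" "e' \<noteq> e" using none by blast
    then have "card {e, e'} \<le> card (?fib y)" using fin e by (intro card_mono) auto
    then show ?thesis using e' by simp
  qed
  have "2 * card (f ` E - F) = (\<Sum>y\<in>f ` E - F. 2)" by simp
  also have "\<dots> \<le> (\<Sum>y\<in>f ` E - F. card (?fib y))" by (intro sum_mono fibre_ge_2)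
  also have "\<dots> = card (\<Union>y\<in>f ` E - F. ?fib y)"
    using fin by (subst card_UN_disjoint) auto
  also have "\<dots> \<le> card E" using fin by (intro card_mono) auto
  finally show False using card by simp
qed

definition nb_sum :: "('v \<Rightarrow> nat \<Rightarrow> 'y) \<Rightarrow> nat \<Rightarrow> ('y \<Rightarrow> bit) \<Rightarrow> 'v \<Rightarrow> bit" where
  "nb_sum nb \<Delta> \<eta> x = (\<Sum>i<\<Delta>. \<eta> (nb x i))"

lemma nb_sum_cong:
  "(\<And>y. y \<in> nbhd nb \<Delta> {x} \<Longrightarrow> \<eta> y = \<eta>' y) \<Longrightarrow> nb_sum nb \<Delta> \<eta> x = nb_sum nb \<Delta> \<eta>' x"
  by (auto simp: nb_sum_def nbhd_def intro!: sum.cong)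

lemma nb_sum_upd_unique:
  assumes "i < \<Delta>" "\<And>i'. i' < \<Delta> \<Longrightarrow> nb x i' = nb x i \<Longrightarrow> i' = i"
  shows "nb_sum nb \<Delta> (\<eta>(nb x i := \<eta> (nb x i) + c)) x = nb_sum nb \<Delta> \<eta> x + c"
proof -
  have "nb_sum nb \<Delta> (\<eta>(nb x i := \<eta> (nb x i) + c)) x =
      (\<Sum>i'<\<Delta>. \<eta> (nb x i') + (if i' = i then c else 0))"
    unfolding nb_sum_def using assms(2) by (intro sum.cong) auto
  also have "\<dots> = nb_sum nb \<Delta> \<eta> x + c"
    using assms(1) by (simp add: sum.distrib nb_sum_def)
  finally show ?thesis .
qed

lemma sum_list_condense:
  "(\<Sum>y\<leftarrow>fst (condense nb \<Delta> (xs, b)). \<eta> y) = (\<Sum>x\<leftarrow>xs. nb_sum nb \<Delta> \<eta> x)"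
  by (induction xs)
    (auto simp: condense_def nb_sum_def interv_sum_list_conv_sum_set_nat o_def atLeast0LessThan)

text \<open>By double counting, some vertex \<open>x\<close> of \<open>Q\<close> has a neighbour outside \<open>F\<close> that no other vertex
  of \<open>Q\<close> shares. Through it the sum of \<open>x\<close> can be corrected after all others.\<close>

lemma nb_sum_solvable:
  assumes "finite Q"
    and "\<And>Q'. Q' \<subseteq> Q \<Longrightarrow> Q' \<noteq> {} \<Longrightarrow> \<Delta> * card Q' < 2 * card (nbhd nb \<Delta> Q' - F)"
  shows "\<exists>\<eta>'. (\<forall>y\<in>F. \<eta>' y = \<eta> y) \<and> (\<forall>x\<in>Q. nb_sum nb \<Delta> \<eta>' x = \<alpha> x)"
  using assms
proof (induction Q rule: finite_remove_induct)
  case empty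
  then show ?case by auto
next
  case (remove Q)
  have "card (Q \<times> {..<\<Delta>}) < 2 * card ((\<lambda>(x, i). nb x i) ` (Q \<times> {..<\<Delta>}) - F)"
    using remove.prems[of Q] remove.hyps(2)
    by (simp add: nbhd_def card_cartesian_product mult.commute)
  from unique_value_exists[OF _ this]
  obtain x i where xi: "x \<in> Q" "i < \<Delta>" "nb x i \<notin> F"
    and uniq: "\<And>x' i'. x' \<in> Q \<Longrightarrow> i' < \<Delta> \<Longrightarrow> nb x' i' = nb x i \<Longrightarrow> x' = x \<and> i' = i"
    using remove.hyps(1) by fastforce
  have "\<exists>\<eta>\<^sub>0. (\<forall>y\<in>F. \<eta>\<^sub>0 y = \<eta> y) \<and> (\<forall>x'\<in>Q - {x}. nb_sum nb \<Delta> \<eta>\<^sub>0 x' = \<alpha> x')"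
    by (rule remove.IH[OF xi(1) remove.prems]) auto
  then obtain \<eta>\<^sub>0 where \<eta>\<^sub>0: "\<And>y. y \<in> F \<Longrightarrow> \<eta>\<^sub>0 y = \<eta> y"
    "\<And>x'. x' \<in> Q - {x} \<Longrightarrow> nb_sum nb \<Delta> \<eta>\<^sub>0 x' = \<alpha> x'" by blast
  define \<eta>\<^sub>x where "\<eta>\<^sub>x = \<eta>\<^sub>0(nb x i := \<eta>\<^sub>0 (nb x i) + (nb_sum nb \<Delta> \<eta>\<^sub>0 x + \<alpha> x))"
  have "nb_sum nb \<Delta> \<eta>\<^sub>x x = nb_sum nb \<Delta> \<eta>\<^sub>0 x + (nb_sum nb \<Delta> \<eta>\<^sub>0 x + \<alpha> x)"
    unfolding \<eta>\<^sub>x_def using uniq[OF xi(1)] by (intro nb_sum_upd_unique[OF xi(2)]) auto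
  then have "nb_sum nb \<Delta> \<eta>\<^sub>x x = \<alpha> x" by (simp flip: add.assoc)
  moreover have "nb_sum nb \<Delta> \<eta>\<^sub>x x' = \<alpha> x'" if "x' \<in> Q - {x}" for x'
  proof -
    have "nb_sum nb \<Delta> \<eta>\<^sub>x x' = nb_sum nb \<Delta> \<eta>\<^sub>0 x'"
      using that uniq[of x'] by (intro nb_sum_cong) (auto simp: \<eta>\<^sub>x_def nbhd_def)
    then show ?thesis using \<eta>\<^sub>0(2)[OF that] by simp
  qed
  moreover have "\<eta>\<^sub>x y = \<eta> y" if "y \<in> F" for y
    using that \<eta>\<^sub>0(1) xi(3) by (auto simp: \<eta>\<^sub>x_def)
  ultimately show ?case by (intro exI[of _ \<eta>\<^sub>x]) blast
qed

locale condensation =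
  fixes V :: "'v set" and nb :: "'v \<Rightarrow> nat \<Rightarrow> 'y" and D d :: nat
  assumes finite_V: "finite V" and D: "0 < D" "D \<le> d"
    and expander: "expander V nb (8 * D) (6 * D) (12 * (d + 1))"
begin

abbreviation "nbs \<equiv> nbhd nb (8 * D)"
abbreviation "nsum \<equiv> nb_sum nb (8 * D)"

text \<open>\<open>X\<close> contains all vertices whose value is essentially fixed by the variables in \<open>Y\<close>: all other
  small sets of vertices keep so many neighbours outside that some of these are unique.\<close>

definition is_closure :: "'y set \<Rightarrow> 'v set \<Rightarrow> bool" where
  "is_closure Y X \<longleftrightarrow> X \<subseteq> V \<and> D * card X \<le> d + 1 \<and>
     (\<forall>Q\<subseteq>V - X. Q \<noteq> {} \<longrightarrow> D * card Q \<le> d + 1 \<longrightarrow> 5 * D * card Q < card (nbs Q - (Y \<union> nbs X)))"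

lemma nbs_Un: "nbs (S \<union> T) = nbs S \<union> nbs T"
  by (auto simp: nbhd_def)

lemma finite_if_subset_V: "S \<subseteq> V \<Longrightarrow> finite S" "S \<subseteq> V \<Longrightarrow> finite (nbs S)"
  using finite_subset[OF _ finite_V] by (auto simp: nbhd_def)

lemma card_nbs_greater:
  assumes "S \<subseteq> V" "S \<noteq> {}" "D * card S \<le> 2 * (d + 1)"
  shows "6 * D * card S < card (nbs S)"
  using expander assms by (auto simp: expander_def)

lemma is_closureD:
  assumes "is_closure Y X"
  shows "X \<subseteq> V" "finite X" "card X \<le> d + 1"
    and "\<And>Q. Q \<subseteq> V - X \<Longrightarrow> Q \<noteq> {} \<Longrightarrow> D * card Q \<le> d + 1 \<Longrightarrow>
      5 * D * card Q < card (nbs Q - (Y \<union> nbs X))"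
proof -
  note X = assms[unfolded is_closure_def]
  show "X \<subseteq> V" using X by (rule conjunct1)
  then show "finite X" by (rule finite_if_subset_V)
  have "1 * card X \<le> D * card X" using D(1) by (intro mult_right_mono) auto
  with X show "card X \<le> d + 1" by linarith
qed (use assms[unfolded is_closure_def] in blast)

lemma is_closure_empty: "is_closure {} {}"
proof -
  have "5 * D * card Q < card (nbs Q)" if "Q \<subseteq> V" "Q \<noteq> {}" "D * card Q \<le> d + 1" for Q
    using card_nbs_greater[OF that(1,2)] that(3) by simp
  then show ?thesis by (auto simp: is_closure_def nbhd_def)
qed

lemma card_le_if_few_new_neighbours:
  assumes X: "X \<subseteq> V" "D * card X \<le> 2 * (d + 1)" and Y: "finite Y" "card Y \<le> d + 1"
    and few: "card (nbs X - Y) \<le> 5 * D * card X"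
  shows "D * card X \<le> d + 1"
proof (cases "X = {}")
  case False
  have "6 * D * card X < card (nbs X)" using card_nbs_greater[OF X(1) False X(2)] .
  also have "\<dots> \<le> card ((nbs X - Y) \<union> Y)"
    using Y finite_if_subset_V[OF X(1)] by (intro card_mono) auto
  also have "\<dots> \<le> card (nbs X - Y) + card Y" by (rule card_Un_le)
  also have "\<dots> \<le> 5 * D * card X + (d + 1)" using few Y(2) by (rule add_mono)
  finally show ?thesis by linarith
qed simp

text \<open>The closure of \<open>Y\<close> is a maximal small set of vertices with few neighbours outside \<open>Y\<close>.\<close>

lemma is_closure_exists:
  assumes Y: "finite Y" "card Y \<le> d + 1"
  shows "\<exists>X. is_closure Y X"
proof -
  define \<F> where "\<F> = {X. X \<subseteq> V \<and> D * card X \<le> 2 * (d + 1) \<and> card (nbs X - Y) \<le> 5 * D * card X}"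
  have "finite \<F>" by (rule finite_subset[of _ "Pow V"]) (use finite_V in \<open>auto simp: \<F>_def\<close>)
  moreover have "{} \<in> \<F>" by (simp add: \<F>_def nbhd_def)
  ultimately obtain X where X: "X \<in> \<F>" and max: "\<And>X'. X' \<in> \<F> \<Longrightarrow> X \<subseteq> X' \<Longrightarrow> X' = X"
    using finite_has_maximal2[of \<F> "{}"] by metis
  have XV: "X \<subseteq> V" using X by (simp add: \<F>_def)
  have small: "D * card X \<le> d + 1"
    using X Y by (intro card_le_if_few_new_neighbours) (auto simp: \<F>_def)
  moreover have "5 * D * card Q < card (nbs Q - (Y \<union> nbs X))"
    if Q: "Q \<subseteq> V - X" "Q \<noteq> {}" "D * card Q \<le> d + 1" for Q
  proof (rule ccontr)
    assume few: "\<not> ?thesis"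
    note fin = finite_if_subset_V[OF XV] finite_if_subset_V[of Q]
    have card_Un: "card (X \<union> Q) = card X + card Q"
      using Q(1) fin by (intro card_Un_disjoint) auto
    have "card (nbs (X \<union> Q) - Y) \<le> card ((nbs X - Y) \<union> (nbs Q - (Y \<union> nbs X)))"
      using fin Q(1) by (intro card_mono) (auto simp: nbs_Un)
    also have "\<dots> \<le> card (nbs X - Y) + card (nbs Q - (Y \<union> nbs X))" by (rule card_Un_le)
    also have "\<dots> \<le> 5 * D * card (X \<union> Q)"
      using X few unfolding card_Un by (simp add: \<F>_def algebra_simps)
    finally have "X \<union> Q \<in> \<F>"
      using XV Q small unfolding \<F>_def by (auto simp: card_Un algebra_simps)
    then have "X \<union> Q = X" using max by blast
    then show False using Q by auto
  qed
  ultimately show ?thesis using XV unfolding is_closure_def by blast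
qed

lemma consistent_condense:
  assumes "xor_vars C \<subseteq> V" "is_closure Y X" "consistent C X (nsum \<eta>)"
  shows "consistent (condense nb (8 * D) ` C) Y \<eta>"
proof -
  have "(\<Sum>y\<leftarrow>L. \<eta> y) = b"
    if xs: "(xs, b) \<in> C" and L: "L = fst (condense nb (8 * D) (xs, b))" "set L \<subseteq> Y" for xs L b
  proof -
    have "x \<in> X" if x: "x \<in> set xs" for x
    proof (rule ccontr)
      assume "x \<notin> X"
      moreover have "x \<in> V" using assms(1) xs x by (auto simp: xor_vars_def)
      ultimately have "5 * D * card {x} < card (nbs {x} - (Y \<union> nbs X))"
        using D by (intro is_closureD(4)[OF assms(2)]) auto
      moreover have "nbs {x} \<subseteq> Y"
        using x L by (force simp: nbhd_def condense_def)
      then have "nbs {x} - (Y \<union> nbs X) = {}" by blast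
      ultimately show False by simp
    qed
    then show ?thesis
      using assms(3) xs unfolding L(1) sum_list_condense by (auto simp: consistent_def)
  qed
  then show ?thesis by (auto simp: consistent_def condense_def)
qed

lemma extend_to_closure:
  assumes "is_closure Y X" "is_closure (Y' \<union> Z) X'" "Y' \<subseteq> Y" "card Z \<le> 1" "finite Z"
    and \<alpha>: "\<And>x. x \<in> X \<Longrightarrow> \<alpha> x = nsum \<eta> x"
  shows "\<exists>\<eta>'. (\<forall>y\<in>Y'. \<eta>' y = \<eta> y) \<and> (\<forall>x\<in>X \<union> X'. nsum \<eta>' x = \<alpha> x)"
proof -
  let ?F = "Y' \<union> Z \<union> nbs X"
  note X = is_closureD[OF assms(1)] and X' = is_closureD[OF assms(2)]
  have "\<exists>\<eta>'. (\<forall>y\<in>?F. \<eta>' y = \<eta> y) \<and> (\<forall>x\<in>X' - X. nsum \<eta>' x = \<alpha> x)"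
  proof (rule nb_sum_solvable)
    fix Q assume Q: "Q \<subseteq> X' - X" "Q \<noteq> {}"
    have "finite Q" using Q(1) X'(2) finite_subset by blast
    then have pos: "0 < D * card Q" using D(1) Q(2) by (simp add: card_gt_0_iff)
    have "D * card Q \<le> D * card X'" using Q(1) X'(2) by (intro mult_left_mono card_mono) auto
    also have "\<dots> \<le> d + 1" using assms(2) by (simp add: is_closure_def)
    finally have "5 * D * card Q < card (nbs Q - (Y \<union> nbs X))"
      using Q X'(1) by (intro X(4)) auto
    also have "\<dots> \<le> card ((nbs Q - ?F) \<union> Z)"
      using finite_if_subset_V(2)[of Q] Q(1) X'(1) assms(3,5) by (intro card_mono) auto
    also have "\<dots> \<le> card (nbs Q - ?F) + card Z" by (rule card_Un_le)
    finally have "5 * D * card Q \<le> card (nbs Q - ?F)" using assms(4) by simp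
    then show "8 * D * card Q < 2 * card (nbs Q - ?F)" using pos by linarith
  qed (use X' in auto)
  then obtain \<eta>' where \<eta>': "\<And>y. y \<in> ?F \<Longrightarrow> \<eta>' y = \<eta> y" "\<And>x. x \<in> X' - X \<Longrightarrow> nsum \<eta>' x = \<alpha> x"
    by blast
  have "nsum \<eta>' x = \<alpha> x" if "x \<in> X" for x
  proof -
    have "nsum \<eta>' x = nsum \<eta> x"
      using that by (intro nb_sum_cong \<eta>'(1)) (auto simp: nbhd_def)
    then show ?thesis using \<alpha>[OF that] by simp
  qed
  then show ?thesis using \<eta>' by (intro exI[of _ \<eta>']) auto
qed

proposition duplicator_wins_condense:
  assumes C: "xor_vars C \<subseteq> V" and wins: "duplicator_wins C (d + 1) (d + 1) r {} \<alpha>"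
  shows "duplicator_wins (condense nb (8 * D) ` C) d 1 r {} \<eta>"
proof (rule duplicator_wins_if_invariant)
  let ?Inv = "\<lambda>r Y \<eta>. \<exists>X. is_closure Y X \<and> duplicator_wins C (d + 1) (d + 1) r X (nsum \<eta>)"
  show "consistent (condense nb (8 * D) ` C) Y \<eta>" if "?Inv r Y \<eta>" for r Y \<eta>
    using that consistent_condense[OF C] duplicator_wins_imp_consistent by blast
  show "\<exists>\<eta>'. (\<forall>y\<in>Y'. \<eta>' y = \<eta> y) \<and> ?Inv r (Y' \<union> Z) \<eta>'"
    if Inv: "?Inv (Suc r) Y \<eta>" and Y': "Y' \<subseteq> Y" "finite Y'" "card Y' \<le> d"
      and Z: "finite Z" "card Z \<le> 1" for r Y \<eta> Y' Z
  proof -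
    obtain X where X: "is_closure Y X" "duplicator_wins C (d + 1) (d + 1) (Suc r) X (nsum \<eta>)"
      using Inv by blast
    have "card (Y' \<union> Z) \<le> d + 1" using card_Un_le[of Y' Z] Y'(3) Z(2) by linarith
    then obtain X' where X': "is_closure (Y' \<union> Z) X'"
      using is_closure_exists[of "Y' \<union> Z"] Y'(2) Z(1) by blast
    obtain \<alpha> where \<alpha>: "\<And>x. x \<in> X \<Longrightarrow> \<alpha> x = nsum \<eta> x"
      "duplicator_wins C (d + 1) (d + 1) r (X \<union> X') \<alpha>"
      using duplicator_wins_respond[OF X(2) order_refl is_closureD(2,3)[OF X(1)]
          is_closureD(2,3)[OF X']] by blast
    obtain \<eta>' where \<eta>': "\<forall>y\<in>Y'. \<eta>' y = \<eta> y" "\<And>x. x \<in> X \<union> X' \<Longrightarrow> nsum \<eta>' x = \<alpha> x"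
      using extend_to_closure[OF X(1) X' Y'(1) Z(2,1) \<alpha>(1)] by blast
    have "duplicator_wins C (d + 1) (d + 1) r X' (nsum \<eta>')"
      using \<alpha>(2) by (rule duplicator_wins_mono) (use \<eta>'(2) in auto)
    then show ?thesis using X' \<eta>'(1) by blast
  qed
  have "duplicator_wins C (d + 1) (d + 1) r {} (nsum \<eta>)"
    using wins by (rule duplicator_wins_mono) auto
  then show "?Inv r {} \<eta>" using is_closure_empty by blast
qed

end

section \<open>Linear systems over the two-element field\<close>

text \<open>If \<open>x\<close> violates an even number of equations, then adding up, over the violated equations \<open>u\<close>,
  the solutions \<open>y u\<close> of all equations except \<open>u\<close> repairs \<open>x\<close>.\<close>

lemma minimal_unsolvable_bit_system_odd:
  fixes f :: "'v \<Rightarrow> 'a :: ab_group_add \<Rightarrow> bit"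
  assumes Z: "finite Z" and add: "\<And>v. v \<in> Z \<Longrightarrow> additive (f v)"
    and unsolvable: "\<nexists>x. \<forall>v\<in>Z. f v x = b v"
    and minimal: "\<And>u. u \<in> Z \<Longrightarrow> \<exists>y. \<forall>v\<in>Z - {u}. f v y = b v"
  shows "(\<Sum>v\<in>Z. f v x + b v) = 1"
proof (rule ccontr)
  obtain y where y: "\<And>u v. u \<in> Z \<Longrightarrow> v \<in> Z - {u} \<Longrightarrow> f v (y u) = b v"
    using minimal by metis
  then have "f u (y u) \<noteq> b u" if "u \<in> Z" for u using unsolvable that by blast
  then have "f u (y u) = b u + 1" if "u \<in> Z" for u
    using that by (cases "f u (y u)"; cases "b u") force+
  with y have y_upd: "f v (y u) = b v + (if u = v then 1 else 0)" if "u \<in> Z" "v \<in> Z" for u v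
    using that by (cases "u = v") simp_all
  define T where "T = {v \<in> Z. f v x \<noteq> b v}"
  have T: "T \<subseteq> Z" "finite T" using Z by (auto simp: T_def)
  have diff: "f v x + b v = of_bool (v \<in> T)" if "v \<in> Z" for v
    using that by (cases "f v x"; cases "b v") (auto simp: T_def)
  assume "(\<Sum>v\<in>Z. f v x + b v) \<noteq> 1"
  with diff have "(\<Sum>v\<in>Z. of_bool (v \<in> T)) = (0 :: bit)" by simp
  then have even: "of_nat (card T) = (0 :: bit)"
    using Z by (simp add: T_def sum_of_bool_eq Int_def)
  have "f v (x + (\<Sum>u\<in>T. y u)) = b v" if v: "v \<in> Z" for v
  proof -
    have "f v (\<Sum>u\<in>T. y u) = (\<Sum>u\<in>T. b v + (if u = v then 1 else 0))"
      unfolding additive.sum[OF add[OF v]] using y_upd v T(1) by (intro sum.cong) auto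
    also have "\<dots> = of_bool (v \<in> T)" using T(2) even by (simp add: sum.distrib)
    finally have "f v (x + (\<Sum>u\<in>T. y u)) = f v x + (f v x + b v)"
      using additive.add[OF add[OF v]] diff[OF v] by simp
    then show ?thesis by (simp flip: add.assoc)
  qed
  with unsolvable show False by blast
qed

lemma additive_bit_system_solvable:
  fixes f :: "'v \<Rightarrow> 'a :: ab_group_add \<Rightarrow> bit"
  assumes "finite Z" and "\<And>v. v \<in> Z \<Longrightarrow> additive (f v)"
    and "\<And>Z'. Z' \<subseteq> Z \<Longrightarrow> \<forall>x. (\<Sum>v\<in>Z'. f v x) = 0 \<Longrightarrow> (\<Sum>v\<in>Z'. b v) = 0"
  shows "\<exists>x. \<forall>v\<in>Z. f v x = b v"
  using assms
proof (induction Z rule: finite_psubset_induct)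
  case (psubset Z)
  have minimal: "\<exists>y. \<forall>v\<in>Z - {u}. f v y = b v" if "u \<in> Z" for u
    using psubset.IH[of "Z - {u}"] psubset.prems that by blast
  show ?case
  proof (rule ccontr)
    assume unsolvable: "\<not> ?thesis"
    have odd: "(\<Sum>v\<in>Z. f v x) + (\<Sum>v\<in>Z. b v) = 1" for x
      using minimal_unsolvable_bit_system_odd[OF psubset.hyps psubset.prems(1) unsolvable minimal]
      by (simp add: sum.distrib)
    moreover have "(\<Sum>v\<in>Z. f v 0) = 0" using psubset.prems(1) by (simp add: additive.zero)
    ultimately have sum_b: "(\<Sum>v\<in>Z. b v) = 1" by (metis add_0)
    then have "(\<Sum>v\<in>Z. f v x) = 0" for x using odd[of x] by simp
    then show False using psubset.prems(2)[of Z] sum_b by simp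
  qed
qed

lemma additive_upd:
  fixes F :: "('i \<Rightarrow> bit) \<Rightarrow> bit"
  assumes "additive F"
  shows "F (x(j := x j + c)) = F x + c * F (\<lambda>i. of_bool (i = j))"
proof (cases c)
  case one
  then have "x(j := x j + c) = x + (\<lambda>i. of_bool (i = j))" by auto
  then show ?thesis using additive.add[OF assms] one by simp
qed simp

lemma additive_eq_restrict:
  fixes F :: "(nat \<Rightarrow> bit) \<Rightarrow> bit"
  assumes "additive F" "\<And>j. j < k \<Longrightarrow> F (\<lambda>i. of_bool (i = j)) = 0"
  shows "F x = F (\<lambda>i. if i < k then 0 else x i)"
  using assms(2)
proof (induction k)
  case (Suc k)
  let ?x = "\<lambda>i. if i < k then 0 else x i"
  have "F (?x(k := ?x k + ?x k)) = F ?x + ?x k * F (\<lambda>i. of_bool (i = k))"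
    by (rule additive_upd[OF assms(1)])
  also have "?x(k := ?x k + ?x k) = (\<lambda>i. if i < Suc k then 0 else x i)" by auto
  finally show ?case using Suc by simp
qed simp

section \<open>A circuit with independent past and future\<close>

text \<open>The circuit has \<open>m\<close> registers. Step \<open>s\<close> adds register \<open>source m s\<close> to register \<open>target m s\<close> if
  \<open>s \<in> \<omega>\<close> and the two registers are different. The target is constant during the \<open>m\<close> steps of a
  period, and the \<open>m\<close> periods of a block run through all pairs of registers. Vertex \<open>(s, j)\<close> is the
  content of register \<open>j\<close> before step \<open>s\<close>.\<close>

definition source :: "nat \<Rightarrow> nat \<Rightarrow> nat" where
  "source m s = s mod m"

definition target :: "nat \<Rightarrow> nat \<Rightarrow> nat" where
  "target m s = s div m mod m"

definition wired :: "nat \<Rightarrow> nat set \<Rightarrow> nat \<Rightarrow> bool" where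
  "wired m \<omega> s \<longleftrightarrow> s \<in> \<omega> \<and> source m s \<noteq> target m s"

definition step :: "nat \<Rightarrow> nat set \<Rightarrow> nat \<Rightarrow> (nat \<Rightarrow> bit) \<Rightarrow> nat \<Rightarrow> bit" where
  "step m \<omega> s x =
     (if wired m \<omega> s then x(target m s := x (target m s) + x (source m s)) else x)"

definition run :: "nat \<Rightarrow> nat set \<Rightarrow> nat \<Rightarrow> nat \<Rightarrow> (nat \<Rightarrow> bit) \<Rightarrow> nat \<Rightarrow> bit" where
  "run m \<omega> a b = fold (step m \<omega>) [a..<b]"

lemma run_refl [simp]: "run m \<omega> a a x = x"
  by (simp add: run_def)

lemma run_Suc: "a \<le> b \<Longrightarrow> run m \<omega> a (Suc b) x = step m \<omega> b (run m \<omega> a b x)"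
  by (simp add: run_def)

lemma run_run: "a \<le> b \<Longrightarrow> b \<le> c \<Longrightarrow> run m \<omega> b c (run m \<omega> a b x) = run m \<omega> a c x"
  unfolding run_def using upt_add_eq_append[of a b "c - b"] by simp

lemma run_add: "run m \<omega> a b (x + y) = run m \<omega> a b x + run m \<omega> a b y"
proof -
  have "step m \<omega> s (x + y) = step m \<omega> s x + step m \<omega> s y" for s x y
    by (simp add: step_def fun_eq_iff add_ac)
  then have "fold (step m \<omega>) ss (x + y) = fold (step m \<omega>) ss x + fold (step m \<omega>) ss y" for ss
    by (induction ss arbitrary: x y) simp_all
  then show ?thesis by (simp add: run_def)
qed

lemma run_surj: "\<exists>x. run m \<omega> a b x = y"
proof -
  have involution: "step m \<omega> s (step m \<omega> s x) = x" for s x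
    by (auto simp: step_def wired_def add.assoc)
  have "\<exists>x. fold (step m \<omega>) ss x = y" for ss
    by (induction ss) (simp, metis fold_simps(2) involution)
  then show ?thesis by (simp add: run_def)
qed

lemma run_cong:
  assumes "\<And>s. a \<le> s \<Longrightarrow> s < b \<Longrightarrow> s \<in> \<omega> \<longleftrightarrow> s \<in> \<omega>'"
  shows "run m \<omega> a b = run m \<omega>' a b"
  unfolding run_def using assms by (intro ext fold_cong) (auto simp: step_def wired_def)

lemma run_eq_0:
  assumes "\<And>i. i < m \<Longrightarrow> x i = 0" "j < m"
  shows "run m \<omega> a b x j = 0"
proof -
  have "\<forall>i<m. fold (step m \<omega>) ss x i = 0" if "\<forall>i<m. x i = 0" for ss x
    using that assms(2) by (induction ss arbitrary: x) (auto simp: step_def source_def)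
  then show ?thesis using assms by (simp add: run_def)
qed

lemma run_period:
  assumes "t \<le> m"
  shows "run m \<omega> (\<tau> * m) (\<tau> * m + t) x =
    x(\<tau> mod m := x (\<tau> mod m) + (\<Sum>i<t. of_bool (wired m \<omega> (\<tau> * m + i)) * x i))"
  using assms
proof (induction t)
  case (Suc t)
  then have "target m (\<tau> * m + t) = \<tau> mod m" "source m (\<tau> * m + t) = t"
    by (simp_all add: target_def source_def)
  then show ?case using Suc by (auto simp: run_Suc step_def wired_def add.assoc)
qed simp

definition period_sum :: "nat \<Rightarrow> nat set \<Rightarrow> nat \<Rightarrow> (nat \<Rightarrow> bit) \<Rightarrow> bit" where
  "period_sum m \<omega> \<tau> x = (\<Sum>i<m. of_bool (wired m \<omega> (\<tau> * m + i)) * x i)"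

definition readout :: "nat \<Rightarrow> nat set \<Rightarrow> nat \<Rightarrow> (nat \<times> nat) set \<Rightarrow> (nat \<Rightarrow> bit) \<Rightarrow> bit" where
  "readout m \<omega> a Z x = (\<Sum>v\<in>Z. run m \<omega> a (fst v) x (snd v))"

lemma additive_run: "additive (\<lambda>x. run m \<omega> a b x j)"
  by (rule additive.intro) (simp add: run_add)

lemma additive_readout: "additive (readout m \<omega> a Z)"
  by (rule additive.intro) (simp add: readout_def run_add sum.distrib)

lemma readout_run:
  assumes "a \<le> b" "\<And>v. v \<in> Z \<Longrightarrow> b \<le> fst v"
  shows "readout m \<omega> b Z (run m \<omega> a b x) = readout m \<omega> a Z x"
  unfolding readout_def using assms by (intro sum.cong) (simp_all add: run_run)

lemma readout_cong:
  assumes "\<And>v s. v \<in> Z \<Longrightarrow> a \<le> s \<Longrightarrow> s < fst v \<Longrightarrow> s \<in> \<omega> \<longleftrightarrow> s \<in> \<omega>'"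
  shows "readout m \<omega> a Z = readout m \<omega>' a Z"
proof -
  have "run m \<omega> a (fst v) = run m \<omega>' a (fst v)" if "v \<in> Z" for v
    using assms that by (intro run_cong)
  then show ?thesis by (simp add: readout_def fun_eq_iff cong: sum.cong)
qed

lemma readout_period:
  assumes "\<And>v. v \<in> Z \<Longrightarrow> Suc \<tau> * m \<le> fst v"
  shows "readout m \<omega> (\<tau> * m) Z x = readout m \<omega> (Suc \<tau> * m) Z x +
    period_sum m \<omega> \<tau> x * readout m \<omega> (Suc \<tau> * m) Z (\<lambda>i. of_bool (i = \<tau> mod m))"
proof -
  have "readout m \<omega> (\<tau> * m) Z x =
      readout m \<omega> (Suc \<tau> * m) Z (run m \<omega> (\<tau> * m) (\<tau> * m + m) x)"
    using readout_run[of "\<tau> * m" "Suc \<tau> * m" Z m \<omega> x] assms by (simp add: add.commute)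
  then show ?thesis
    unfolding run_period[OF order_refl] additive_upd[OF additive_readout] period_sum_def .
qed

lemma readout_eq_0_if_independent_of_targets:
  assumes late: "\<And>v. v \<in> Z \<Longrightarrow> Suc g * m * m \<le> fst v \<and> snd v < m"
    and indep: "\<And>j. j < m \<Longrightarrow> readout m \<omega> (Suc (g * m + j) * m) Z (\<lambda>i. of_bool (i = j)) = 0"
  shows "readout m \<omega> 0 Z x = 0"
proof -
  let ?R = "\<lambda>j. readout m \<omega> ((g * m + j) * m) Z"
  have shift: "?R j = ?R (Suc j)" if "j < m" for j
  proof
    fix y
    have "Suc (g * m + j) * m \<le> Suc g * m * m" using that by (intro mult_right_mono) auto
    then have "Suc (g * m + j) * m \<le> fst v" if "v \<in> Z" for v using late[OF that] by simp
    from readout_period[OF this] show "?R j y = ?R (Suc j) y" using indep[OF that] that by simp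
  qed
  have last: "?R j = ?R m" if "j \<le> m" for j
    using that by (induction rule: inc_induct) (simp_all add: shift)
  have "?R m y = 0" for y
  proof -
    have "?R m y = ?R m (\<lambda>i. if i < m then 0 else y i)"
      using indep last[of "Suc _"] by (intro additive_eq_restrict additive_readout) simp
    also have "\<dots> = 0"
      unfolding readout_def using late by (intro sum.neutral ballI run_eq_0) auto
    finally show ?thesis .
  qed
  moreover have "readout m \<omega> 0 Z x = ?R m (run m \<omega> 0 ((g * m + m) * m) x)"
    using late by (intro readout_run[symmetric]) (auto simp: add.commute)
  ultimately show ?thesis by simp
qed

text \<open>The last condition makes the sum over \<open>Zh\<close> depend on the target register of period \<open>\<tau>\<close>, so that
  the bits of \<open>\<omega>\<close> for this period are determined by all others.\<close>

definition collisions :: "nat \<Rightarrow> nat \<Rightarrow> (nat \<times> nat) set \<Rightarrow> (nat \<times> nat) set \<Rightarrow> nat set set" where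
  "collisions m \<tau> Zl Zh = {\<omega>. (\<forall>v\<in>Zl. fst v \<le> \<tau> * m) \<and> (\<forall>v\<in>Zh. Suc \<tau> * m \<le> fst v) \<and>
     readout m \<omega> 0 Zl = readout m \<omega> 0 Zh \<and>
     readout m \<omega> (Suc \<tau> * m) Zh (\<lambda>i. of_bool (i = \<tau> mod m)) = 1}"

lemma readout_collision:
  fixes x :: "nat \<Rightarrow> bit"
  assumes \<omega>: "\<omega> \<in> collisions m \<tau> Zl Zh"
  defines "y \<equiv> run m \<omega> 0 (\<tau> * m) x"
  shows "readout m \<omega> 0 Zl x = readout m \<omega> (Suc \<tau> * m) Zh y + period_sum m \<omega> \<tau> y"
proof -
  have late: "Suc \<tau> * m \<le> fst v" if "v \<in> Zh" for v using \<omega> that by (auto simp: collisions_def)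
  then have "\<tau> * m \<le> fst v" if "v \<in> Zh" for v using that by fastforce
  then have "readout m \<omega> 0 Zh x = readout m \<omega> (\<tau> * m) Zh y"
    by (simp add: readout_run y_def)
  then show ?thesis
    using readout_period[OF late, where \<omega> = \<omega> and x = y] \<omega> by (simp add: collisions_def)
qed

lemma collisions_inj:
  assumes \<omega>: "\<omega> \<in> collisions m \<tau> Zl Zh" and \<omega>': "\<omega>' \<in> collisions m \<tau> Zl Zh"
    and agree: "\<omega> - (+) (\<tau> * m) ` ({..<m} - {\<tau> mod m}) = \<omega>' - (+) (\<tau> * m) ` ({..<m} - {\<tau> mod m})"
  shows "\<omega> = \<omega>'"
proof -
  let ?J = "(+) (\<tau> * m) ` ({..<m} - {\<tau> mod m})"
  have off: "s \<in> \<omega> \<longleftrightarrow> s \<in> \<omega>'" if "s \<notin> ?J" for s using agree that by blast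
  have before: "s \<in> \<omega> \<longleftrightarrow> s \<in> \<omega>'" if "s < \<tau> * m" for s using that by (intro off) auto
  have after: "s \<in> \<omega> \<longleftrightarrow> s \<in> \<omega>'" if "Suc \<tau> * m \<le> s" for s using that by (intro off) auto
  have low: "readout m \<omega> 0 Zl = readout m \<omega>' 0 Zl"
    using \<omega> by (intro readout_cong before) (auto simp: collisions_def)
  have high: "readout m \<omega> (Suc \<tau> * m) Zh = readout m \<omega>' (Suc \<tau> * m) Zh"
    by (intro readout_cong after)
  have start: "run m \<omega> 0 (\<tau> * m) = run m \<omega>' 0 (\<tau> * m)"
    by (intro run_cong before)
  have same_sum: "period_sum m \<omega> \<tau> y = period_sum m \<omega>' \<tau> y" for y
  proof -
    obtain x where "run m \<omega> 0 (\<tau> * m) x = y" using run_surj by blast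
    then show ?thesis
      using readout_collision[OF \<omega>, of x] readout_collision[OF \<omega>', of x] low start high by simp
  qed
  have on: "\<tau> * m + i \<in> \<omega> \<longleftrightarrow> \<tau> * m + i \<in> \<omega>'" if i: "i < m" "i \<noteq> \<tau> mod m" for i
  proof -
    have "period_sum m \<chi> \<tau> (\<lambda>l. of_bool (l = i)) = of_bool (wired m \<chi> (\<tau> * m + i))" for \<chi>
      using i(1) by (simp add: period_sum_def)
    then have "wired m \<omega> (\<tau> * m + i) \<longleftrightarrow> wired m \<omega>' (\<tau> * m + i)"
      using same_sum[of "\<lambda>l. of_bool (l = i)"] by (simp add: of_bool_def split: if_splits)
    then show ?thesis using i by (simp add: wired_def source_def target_def)
  qed
  have "s \<in> \<omega> \<longleftrightarrow> s \<in> \<omega>'" for s using on off by (cases "s \<in> ?J") auto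
  then show "\<omega> = \<omega>'" by blast
qed

lemma card_collisions_le:
  assumes "\<tau> < T" "0 < m"
  shows "card (collisions m \<tau> Zl Zh \<inter> Pow {..<T * m}) \<le> 2 ^ (T * m - (m - 1))"
proof -
  let ?J = "(+) (\<tau> * m) ` ({..<m} - {\<tau> mod m})"
  have "Suc \<tau> * m \<le> T * m" using assms(1) by (intro mult_right_mono) auto
  then have J: "?J \<subseteq> {..<T * m}" by auto
  have card_J: "card ?J = m - 1" using assms(2) by (simp add: card_image)
  have "inj_on (\<lambda>\<omega>. \<omega> - ?J) (collisions m \<tau> Zl Zh \<inter> Pow {..<T * m})"
    using collisions_inj by (intro inj_onI) blast
  moreover have "(\<lambda>\<omega>. \<omega> - ?J) ` (collisions m \<tau> Zl Zh \<inter> Pow {..<T * m}) \<subseteq> Pow ({..<T * m} - ?J)"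
    by auto
  ultimately have "card (collisions m \<tau> Zl Zh \<inter> Pow {..<T * m}) \<le> card (Pow ({..<T * m} - ?J))"
    by (intro card_inj_on_le) auto
  also have "\<dots> = 2 ^ (T * m - (m - 1))"
    using J card_J by (simp add: card_Pow card_Diff_subset finite_subset)
  finally show ?thesis .
qed

lemma card_small_subsets_le:
  assumes "finite A"
  shows "card {Z. Z \<subseteq> A \<and> card Z \<le> p} \<le> (card A + 1) ^ p"
proof (induction p)
  case 0
  have "{Z. Z \<subseteq> A \<and> card Z \<le> 0} \<subseteq> {{}}" using assms finite_subset by fastforce
  from card_mono[OF _ this] show ?case by simp
next
  case (Suc p)
  let ?\<Z> = "{Z. Z \<subseteq> A \<and> card Z \<le> p}"
  have fin: "finite ?\<Z>" using assms by simp
  have "{Z. Z \<subseteq> A \<and> card Z \<le> Suc p} \<subseteq> ?\<Z> \<union> (\<lambda>(a, Z). insert a Z) ` (A \<times> ?\<Z>)"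
  proof
    fix Z assume Z: "Z \<in> {Z. Z \<subseteq> A \<and> card Z \<le> Suc p}"
    show "Z \<in> ?\<Z> \<union> (\<lambda>(a, Z). insert a Z) ` (A \<times> ?\<Z>)"
    proof (cases "Z = {}")
      case False
      then obtain a where a: "a \<in> Z" by blast
      then have "(a, Z - {a}) \<in> A \<times> ?\<Z>" using Z assms finite_subset[of Z A] by auto
      moreover have "Z = insert a (Z - {a})" using a by blast
      ultimately show ?thesis by (metis (no_types, lifting) UnI2 case_prod_conv imageI)
    qed simp
  qed
  then have "card {Z. Z \<subseteq> A \<and> card Z \<le> Suc p} \<le> card (?\<Z> \<union> (\<lambda>(a, Z). insert a Z) ` (A \<times> ?\<Z>))"
    using fin assms by (intro card_mono) auto
  also have "\<dots> \<le> card ?\<Z> + card A * card ?\<Z>"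
    using card_image_le[of "A \<times> ?\<Z>" "\<lambda>(a, Z). insert a Z"] fin assms
    by (intro order_trans[OF card_Un_le] add_left_mono) (simp add: card_cartesian_product)
  also have "\<dots> = (card A + 1) * card ?\<Z>" by simp
  also have "\<dots> \<le> (card A + 1) ^ Suc p"
    unfolding power_Suc using Suc.IH by (rule mult_left_mono) simp
  finally show ?case .
qed

definition vertices :: "nat \<Rightarrow> nat \<Rightarrow> (nat \<times> nat) set" where
  "vertices m G = {..G * m * m} \<times> {..<m}"

definition before_block :: "nat \<Rightarrow> nat \<Rightarrow> nat \<times> nat \<Rightarrow> bool" where
  "before_block m g v \<longleftrightarrow> fst v \<le> g * m * m"

definition after_block :: "nat \<Rightarrow> nat \<Rightarrow> nat \<times> nat \<Rightarrow> bool" where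
  "after_block m g v \<longleftrightarrow> Suc g * m * m \<le> fst v"

definition separating :: "nat \<Rightarrow> nat \<Rightarrow> nat \<Rightarrow> nat set \<Rightarrow> bool" where
  "separating m G p \<omega> \<longleftrightarrow> (\<forall>g<G. \<forall>Zl\<subseteq>vertices m G. \<forall>Zh\<subseteq>vertices m G.
     card Zl \<le> p \<longrightarrow> card Zh \<le> p \<longrightarrow>
     (\<forall>v\<in>Zl. before_block m g v) \<longrightarrow> (\<forall>v\<in>Zh. after_block m g v) \<longrightarrow>
     readout m \<omega> 0 Zl = readout m \<omega> 0 Zh \<longrightarrow> (\<forall>x. readout m \<omega> 0 Zh x = 0))"

lemma finite_vertices [simp]: "finite (vertices m G)"
  by (simp add: vertices_def)

lemma separating_if_no_collision:
  assumes none: "\<And>\<tau> Zl Zh. \<tau> < G * m \<Longrightarrow> Zl \<subseteq> vertices m G \<Longrightarrow> card Zl \<le> p \<Longrightarrow>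
      Zh \<subseteq> vertices m G \<Longrightarrow> card Zh \<le> p \<Longrightarrow> \<omega> \<notin> collisions m \<tau> Zl Zh"
  shows "separating m G p \<omega>"
  unfolding separating_def
proof (intro allI impI)
  fix g Zl Zh x
  assume g: "g < G" and Z: "Zl \<subseteq> vertices m G" "Zh \<subseteq> vertices m G" "card Zl \<le> p" "card Zh \<le> p"
    and before: "\<forall>v\<in>Zl. before_block m g v" and after: "\<forall>v\<in>Zh. after_block m g v"
    and eq: "readout m \<omega> 0 Zl = readout m \<omega> 0 Zh"
  show "readout m \<omega> 0 Zh x = 0"
  proof (rule readout_eq_0_if_independent_of_targets)
    show "Suc g * m * m \<le> fst v \<and> snd v < m" if "v \<in> Zh" for v
      using that after Z(2) by (auto simp: after_block_def vertices_def)
    fix j assume j: "j < m"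
    have "Suc g * m \<le> G * m" using g by (intro mult_right_mono) auto
    then have \<tau>: "g * m + j < G * m" using j by simp
    have "Suc (g * m + j) * m \<le> Suc g * m * m" using j by (intro mult_right_mono) auto
    then have late: "Suc (g * m + j) * m \<le> fst v" if "v \<in> Zh" for v
      using that after by (fastforce simp: after_block_def)
    have early: "fst v \<le> (g * m + j) * m" if "v \<in> Zl" for v
      using that before by (fastforce simp: before_block_def algebra_simps)
    show "readout m \<omega> (Suc (g * m + j) * m) Zh (\<lambda>i. of_bool (i = j)) = 0"
    proof (rule ccontr)
      assume "readout m \<omega> (Suc (g * m + j) * m) Zh (\<lambda>i. of_bool (i = j)) \<noteq> 0"
      then have "\<omega> \<in> collisions m (g * m + j) Zl Zh"
        using early late eq j by (simp add: collisions_def)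
      then show False using none[OF \<tau> Z(1,3,2,4)] by blast
    qed
  qed
qed

lemma separating_exists:
  assumes m: "0 < m" and G: "0 < G"
    and bound: "G * m * ((card (vertices m G) + 1) ^ p)\<^sup>2 < 2 ^ (m - 1)"
  shows "\<exists>\<omega>. separating m G p \<omega>"
proof -
  let ?T = "G * m"
  define \<Z> where "\<Z> = {Z. Z \<subseteq> vertices m G \<and> card Z \<le> p}"
  define I where "I = {..<?T} \<times> \<Z> \<times> \<Z>"
  define Bad where "Bad = (\<lambda>(\<tau>, Zl, Zh). collisions m \<tau> Zl Zh \<inter> Pow {..<?T * m})"
  have fin: "finite I" by (simp add: I_def \<Z>_def)
  have "card \<Z> \<le> (card (vertices m G) + 1) ^ p"
    unfolding \<Z>_def by (rule card_small_subsets_le) simp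
  then have "card I \<le> ?T * ((card (vertices m G) + 1) ^ p)\<^sup>2"
    by (simp add: I_def card_cartesian_product power2_eq_square mult_le_mono)
  also note bound
  finally have card_I: "card I < 2 ^ (m - 1)" .
  have "card (\<Union>x\<in>I. Bad x) \<le> (\<Sum>x\<in>I. card (Bad x))" by (rule card_UN_le[OF fin])
  also have "\<dots> \<le> (\<Sum>x\<in>I. 2 ^ (?T * m - (m - 1)))"
    using card_collisions_le[OF _ m] by (intro sum_mono) (auto simp: I_def Bad_def)
  also have "\<dots> < 2 ^ (m - 1) * 2 ^ (?T * m - (m - 1))"
    using card_I by simp
  also have "\<dots> = card (Pow {..<?T * m})"
  proof -
    have "1 * 1 * m \<le> G * m * m" using G m by (intro mult_le_mono) auto
    then have "m - 1 + (?T * m - (m - 1)) = ?T * m" by linarith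
    then show ?thesis by (simp only: power_add[symmetric] card_Pow finite_lessThan card_lessThan)
  qed
  finally have "\<not> Pow {..<?T * m} \<subseteq> (\<Union>x\<in>I. Bad x)"
    using fin by (auto simp: Bad_def not_le dest!: card_mono[rotated])
  then obtain \<omega> where "\<omega> \<subseteq> {..<?T * m}" "\<And>x. x \<in> I \<Longrightarrow> \<omega> \<notin> Bad x" by auto
  then have "separating m G p \<omega>"
    by (intro separating_if_no_collision) (auto simp: I_def \<Z>_def Bad_def)
  then show ?thesis ..
qed

section \<open>The XOR system of the circuit\<close>

abbreviation content :: "nat \<Rightarrow> nat set \<Rightarrow> (nat \<Rightarrow> bit) \<Rightarrow> nat \<times> nat \<Rightarrow> bit" where
  "content m \<omega> x v \<equiv> run m \<omega> 0 (fst v) x (snd v)"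

definition sink :: "nat \<Rightarrow> nat \<Rightarrow> nat \<times> nat" where
  "sink m G = (G * m * m, 0)"

definition gate :: "nat \<Rightarrow> nat set \<Rightarrow> nat \<Rightarrow> nat \<Rightarrow> (nat \<times> nat) list" where
  "gate m \<omega> s j =
     (Suc s, j) # (s, j) # (if j = target m s \<and> wired m \<omega> s then [(s, source m s)] else [])"

definition circuit_system :: "nat \<Rightarrow> nat \<Rightarrow> nat set \<Rightarrow> ((nat \<times> nat) list \<times> bit) set" where
  "circuit_system m G \<omega> = insert ([sink m G], 1) ((\<lambda>j. ([(0, j)], 0)) ` {..<m} \<union>
     (\<lambda>(s, j). (gate m \<omega> s j, 0)) ` ({..<G * m * m} \<times> {..<m}))"

lemma finite_circuit_system [simp]: "finite (circuit_system m G \<omega>)"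
  by (simp add: circuit_system_def)

lemma sink_in_vertices: "0 < m \<Longrightarrow> sink m G \<in> vertices m G"
  by (simp add: sink_def vertices_def)

lemma xor_vars_circuit_system: "0 < m \<Longrightarrow> xor_vars (circuit_system m G \<omega>) \<subseteq> vertices m G"
  by (auto simp: xor_vars_def circuit_system_def gate_def vertices_def sink_def source_def
      split: if_splits)

lemma length_circuit_system: "c \<in> circuit_system m G \<omega> \<Longrightarrow> length (fst c) \<le> 3"
  by (auto simp: circuit_system_def gate_def)

lemma circuit_system_derives:
  assumes "v \<in> vertices m G"
  shows "\<exists>us. (v # us, 0) \<in> circuit_system m G \<omega> \<and> length us < 3 \<and> set us \<subseteq> vertices m G \<and>
    (\<forall>u\<in>set us. fst u < fst v)"
proof (cases v)
  case (Pair t j)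
  show ?thesis
  proof (cases t)
    case 0
    then show ?thesis
      using assms Pair by (intro exI[of _ "[]"]) (auto simp: circuit_system_def vertices_def)
  next
    case (Suc s)
    let ?us = "tl (gate m \<omega> s j)"
    have sj: "s < G * m * m" "j < m" using assms Pair Suc by (auto simp: vertices_def)
    then have "(v # ?us, 0) \<in> circuit_system m G \<omega>"
      using Pair Suc by (force simp: circuit_system_def gate_def)
    then show ?thesis
      using sj Pair Suc
      by (intro exI[of _ ?us]) (auto simp: gate_def vertices_def source_def split: if_splits)
  qed
qed

lemma content_Suc: "content m \<omega> x (Suc s, j) = content m \<omega> x (s, j) +
    (if j = target m s \<and> wired m \<omega> s then content m \<omega> x (s, source m s) else 0)"
  by (simp add: run_Suc step_def)

lemma before_block_imp_not_after_block:
  assumes "0 < m" "before_block m g v"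
  shows "\<not> after_block m g v"
proof -
  have "g * m * m < Suc g * m * m" using assms(1) by simp
  then show ?thesis using assms(2) unfolding before_block_def after_block_def by linarith
qed

lemma after_block_sink: "g < G \<Longrightarrow> after_block m g (sink m G)"
  unfolding after_block_def sink_def fst_conv by (intro mult_right_mono) auto

text \<open>Duplicator's invariant: no pebbled vertex lies inside block \<open>g\<close>, all vertices before this block
  have value \<open>0\<close>, and all vertices after it have the values of the run on input \<open>x\<close>. If the output
  on \<open>x\<close> is \<open>1\<close>, the only inconsistency is hidden inside the block.\<close>

definition follows_run_after ::
    "nat \<Rightarrow> nat \<Rightarrow> nat set \<Rightarrow> nat \<Rightarrow> (nat \<Rightarrow> bit) \<Rightarrow> (nat \<times> nat) set \<Rightarrow> (nat \<times> nat \<Rightarrow> bit) \<Rightarrow> bool" where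
  "follows_run_after m G \<omega> g x X \<alpha> \<longleftrightarrow> (\<forall>v\<in>X \<inter> vertices m G.
     before_block m g v \<and> \<alpha> v = 0 \<or> after_block m g v \<and> \<alpha> v = content m \<omega> x v)"

lemma follows_run_afterD:
  assumes "follows_run_after m G \<omega> g x X \<alpha>" "0 < m" "v \<in> X" "v \<in> vertices m G"
  shows "before_block m g v \<or> after_block m g v"
    and "before_block m g v \<Longrightarrow> \<alpha> v = 0"
    and "after_block m g v \<Longrightarrow> \<alpha> v = content m \<omega> x v"
  using assms before_block_imp_not_after_block[OF assms(2), of g v]
  unfolding follows_run_after_def by blast+

lemma gate_satisfied_if_follows_run_after:
  assumes \<alpha>: "follows_run_after m G \<omega> g x X \<alpha>" and m: "2 \<le> m"
    and s: "s < G * m * m" and j: "j < m" and X: "set (gate m \<omega> s j) \<subseteq> X"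
  shows "(\<Sum>v\<leftarrow>gate m \<omega> s j. \<alpha> v) = 0"
proof -
  have m0: "0 < m" using m by simp
  have V: "set (gate m \<omega> s j) \<subseteq> vertices m G"
    using s j m0 by (auto simp: gate_def vertices_def source_def)
  note \<alpha>D = follows_run_afterD[OF \<alpha> m0 subsetD[OF X] subsetD[OF V]]
  have mem: "(Suc s, j) \<in> set (gate m \<omega> s j)" "(s, j) \<in> set (gate m \<omega> s j)"
    by (simp_all add: gate_def)
  have level: "v \<in> {Suc s, s} \<times> UNIV" if "v \<in> set (gate m \<omega> s j)" for v
    using that by (auto simp: gate_def split: if_splits)
  show ?thesis
  proof (cases "before_block m g (Suc s, j)")
    case True
    then have "before_block m g v" if "v \<in> set (gate m \<omega> s j)" for v
      using level[OF that] by (auto simp: before_block_def)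
    then have "\<alpha> v = 0" if "v \<in> set (gate m \<omega> s j)" for v using \<alpha>D(2) that by blast
    then show ?thesis by (simp add: gate_def)
  next
    case False
    then have "after_block m g (Suc s, j)" using \<alpha>D(1)[OF mem(1) mem(1)] by blast
    moreover from this have "\<not> before_block m g (s, j)"
      using mult_le_mono[OF m m] by (simp add: before_block_def after_block_def add_mult_distrib)
    then have "after_block m g (s, j)" using \<alpha>D(1)[OF mem(2) mem(2)] by blast
    ultimately have "after_block m g v" if "v \<in> set (gate m \<omega> s j)" for v
      using level[OF that] by (auto simp: after_block_def)
    then have "\<alpha> v = content m \<omega> x v" if "v \<in> set (gate m \<omega> s j)" for v using \<alpha>D(3) that by blast
    then show ?thesis using content_Suc[where x = x] by (simp add: gate_def)
  qed
qed

lemma consistent_if_follows_run_after: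
  assumes m: "2 \<le> m" and g: "g < G" and sink1: "content m \<omega> x (sink m G) = 1"
    and \<alpha>: "follows_run_after m G \<omega> g x X \<alpha>"
  shows "consistent (circuit_system m G \<omega>) X \<alpha>"
proof -
  have m0: "0 < m" using m by simp
  have "\<alpha> (sink m G) = 1" if "sink m G \<in> X"
    using follows_run_afterD(3)[OF \<alpha> m0 that sink_in_vertices[OF m0] after_block_sink[OF g]] sink1
    by simp
  moreover have "\<alpha> (0, j) = 0" if "(0, j) \<in> X" "j < m" for j
    using that by (intro follows_run_afterD(2)[OF \<alpha> m0]) (auto simp: vertices_def before_block_def)
  ultimately show ?thesis
    using gate_satisfied_if_follows_run_after[OF \<alpha> m]
    by (auto simp: consistent_def circuit_system_def)
qed

lemma free_block_exists:
  assumes "finite X" "card X < Q"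
  shows "\<exists>g. r * Q \<le> g \<and> g < Suc r * Q \<and> (\<forall>v\<in>X. before_block m g v \<or> after_block m g v)"
proof (rule ccontr)
  assume none: "\<not> ?thesis"
  have "\<exists>v\<in>X. g = fst v div (m * m)" if g: "g \<in> {r * Q..<Suc r * Q}" for g
  proof -
    obtain v where v: "v \<in> X" "\<not> before_block m g v" "\<not> after_block m g v"
      using none g by (meson atLeastLessThan_iff)
    then have "g = fst v div (m * m)"
      by (intro div_nat_eqI[symmetric])
        (auto simp: before_block_def after_block_def mult_ac)
    then show ?thesis using v by blast
  qed
  then have "{r * Q..<Suc r * Q} \<subseteq> (\<lambda>v. fst v div (m * m)) ` X" by blast
  then have "card {r * Q..<Suc r * Q} \<le> card X"
    using assms(1) by (meson card_image_le card_mono finite_imageI le_trans)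
  then show False using assms(2) by simp
qed

lemma separating_input_exists:
  assumes sep: "separating m G p \<omega>" and m: "0 < m" and g: "g < G"
    and L: "L \<subseteq> vertices m G" "card L \<le> p" "\<And>v. v \<in> L \<Longrightarrow> before_block m g v"
    and H: "H \<subseteq> vertices m G" "card H \<le> p" "\<And>v. v \<in> H \<Longrightarrow> after_block m g v"
  shows "\<exists>x'. (\<forall>v\<in>L. content m \<omega> x' v = 0) \<and> (\<forall>v\<in>H. content m \<omega> x' v = content m \<omega> x v)"
proof -
  define b where "b v = (if v \<in> L then 0 else content m \<omega> x v)" for v
  have fin: "finite L" "finite H" using L(1) H(1) finite_subset[OF _ finite_vertices] by auto
  have disj: "L \<inter> H = {}" using L(3) H(3) before_block_imp_not_after_block[OF m] by blast
  have "\<exists>x'. \<forall>v\<in>L \<union> H. content m \<omega> x' v = b v"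
  proof (rule additive_bit_system_solvable)
    fix Z assume Z: "Z \<subseteq> L \<union> H" and zero: "\<forall>y. (\<Sum>v\<in>Z. content m \<omega> y v) = 0"
    have split: "sum f Z = sum f (Z \<inter> L) + sum f (Z \<inter> H)" for f :: "nat \<times> nat \<Rightarrow> bit"
    proof -
      have "Z = (Z \<inter> L) \<union> (Z \<inter> H)" using Z by blast
      then show ?thesis
        using fin disj sum.union_disjoint[of "Z \<inter> L" "Z \<inter> H" f] by fastforce
    qed
    have "readout m \<omega> 0 (Z \<inter> L) = readout m \<omega> 0 (Z \<inter> H)"
      using zero by (simp add: split readout_def fun_eq_iff)
    moreover have "card (Z \<inter> L) \<le> p" "card (Z \<inter> H) \<le> p"
      using L(2) H(2) card_mono[OF fin(1), of "Z \<inter> L"] card_mono[OF fin(2), of "Z \<inter> H"] by auto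
    moreover have "Z \<inter> L \<subseteq> vertices m G" "Z \<inter> H \<subseteq> vertices m G"
      "\<forall>v\<in>Z \<inter> L. before_block m g v" "\<forall>v\<in>Z \<inter> H. after_block m g v"
      using L H by auto
    ultimately have "readout m \<omega> 0 (Z \<inter> H) x = 0"
      using sep g unfolding separating_def by blast
    moreover have "(\<Sum>v\<in>Z \<inter> H. b v) = readout m \<omega> 0 (Z \<inter> H) x"
      unfolding readout_def using disj by (intro sum.cong) (auto simp: b_def)
    moreover have "(\<Sum>v\<in>Z \<inter> L. b v) = 0" by (intro sum.neutral) (simp add: b_def)
    ultimately show "(\<Sum>v\<in>Z. b v) = 0" by (simp add: split)
  qed (use fin additive_run in auto)
  then obtain x' where x': "\<forall>v\<in>L \<union> H. content m \<omega> x' v = b v" ..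
  then have "\<forall>v\<in>L. content m \<omega> x' v = 0" by (simp add: b_def)
  moreover have "\<forall>v\<in>H. content m \<omega> x' v = content m \<omega> x v"
    using x' disj by (auto simp: b_def)
  ultimately show ?thesis by blast
qed

lemma follows_run_after_earlier_block:
  assumes \<alpha>: "follows_run_after m G \<omega> g x X \<alpha>" and m: "0 < m" and g': "g' \<le> g"
    and free: "\<And>v. v \<in> X \<Longrightarrow> before_block m g' v \<or> after_block m g' v"
    and before: "\<And>v. v \<in> X \<inter> vertices m G \<Longrightarrow> before_block m g v \<Longrightarrow> content m \<omega> x' v = 0"
    and after: "\<And>v. v \<in> X \<inter> vertices m G \<Longrightarrow> after_block m g v \<Longrightarrow>
      content m \<omega> x' v = content m \<omega> x v"
  shows "follows_run_after m G \<omega> g' x' X \<alpha>"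
  unfolding follows_run_after_def
proof
  fix v assume v: "v \<in> X \<inter> vertices m G"
  note \<alpha>D = follows_run_afterD[OF \<alpha> m IntD1[OF v] IntD2[OF v]]
  show "before_block m g' v \<and> \<alpha> v = 0 \<or> after_block m g' v \<and> \<alpha> v = content m \<omega> x' v"
  proof (cases "before_block m g v")
    case True
    then show ?thesis using \<alpha>D(2) before[OF v] free[of v] v by auto
  next
    case False
    then have late: "after_block m g v" using \<alpha>D(1) by blast
    have "Suc g' * m * m \<le> Suc g * m * m" using g' by (intro mult_right_mono) auto
    then have "after_block m g' v" using late unfolding after_block_def by (rule order_trans)
    then show ?thesis using \<alpha>D(3) after[OF v] late by simp
  qed
qed

lemma follows_run_after_extend:
  assumes sep: "separating m G (p + 1) \<omega>" and m: "0 < m" and g: "g < G" "g' \<le> g"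
    and sink1: "content m \<omega> x (sink m G) = 1" and \<alpha>: "follows_run_after m G \<omega> g x X \<alpha>"
    and X: "finite X" "card X \<le> p"
    and free: "\<And>v. v \<in> X \<union> Y \<Longrightarrow> before_block m g' v \<or> after_block m g' v"
  shows "\<exists>x' \<alpha>'. content m \<omega> x' (sink m G) = 1 \<and> (\<forall>v\<in>X. \<alpha>' v = \<alpha> v) \<and>
    follows_run_after m G \<omega> g' x' (X \<union> Y) \<alpha>'"
proof -
  let ?V = "vertices m G"
  define L where "L = {v \<in> X \<inter> ?V. before_block m g v}"
  define H where "H = insert (sink m G) {v \<in> X \<inter> ?V. after_block m g v}"
  have "card L \<le> card X" using X(1) by (intro card_mono) (auto simp: L_def)
  moreover have "card H \<le> card (insert (sink m G) X)"
    using X(1) by (intro card_mono) (auto simp: H_def)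
  ultimately have cards: "card L \<le> p + 1" "card H \<le> p + 1"
    using X card_insert_le_m1[of "p + 1" X "sink m G"] by auto
  have "L \<subseteq> ?V" "H \<subseteq> ?V" "\<And>v. v \<in> L \<Longrightarrow> before_block m g v" "\<And>v. v \<in> H \<Longrightarrow> after_block m g v"
    using sink_in_vertices[OF m] after_block_sink[OF g(1)] by (auto simp: L_def H_def)
  then obtain x' where x': "\<And>v. v \<in> L \<Longrightarrow> content m \<omega> x' v = 0"
    "\<And>v. v \<in> H \<Longrightarrow> content m \<omega> x' v = content m \<omega> x v"
    using separating_input_exists[OF sep m g(1), of L H x] cards by blast
  have "follows_run_after m G \<omega> g' x' X \<alpha>"
    using free by (intro follows_run_after_earlier_block[OF \<alpha> m g(2)] x') (auto simp: L_def H_def)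
  moreover define \<alpha>' where
    "\<alpha>' v = (if v \<in> X then \<alpha> v else if before_block m g' v then 0 else content m \<omega> x' v)" for v
  ultimately have "follows_run_after m G \<omega> g' x' (X \<union> Y) \<alpha>'"
    using free unfolding follows_run_after_def \<alpha>'_def by (metis IntE IntI)
  moreover have "content m \<omega> x' (sink m G) = 1" using x'(2) sink1 by (simp add: H_def)
  ultimately show ?thesis by (intro exI[of _ x'] exI[of _ \<alpha>']) (simp add: \<alpha>'_def)
qed

proposition duplicator_wins_circuit_system:
  assumes sep: "separating m G (p + 1) \<omega>" and m: "2 \<le> m" and R: "R * (p + q + 1) < G"
  shows "duplicator_wins (circuit_system m G \<omega>) p q R {} \<alpha>"
proof (rule duplicator_wins_if_invariant)
  let ?Inv = "\<lambda>r X \<alpha>. \<exists>g x. g < G \<and> r * (p + q + 1) \<le> g \<and> content m \<omega> x (sink m G) = 1 \<and>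
    follows_run_after m G \<omega> g x X \<alpha>"
  show "consistent (circuit_system m G \<omega>) X \<alpha>" if "?Inv r X \<alpha>" for r X \<alpha>
    using that consistent_if_follows_run_after[OF m] by blast
  show "\<exists>\<alpha>'. (\<forall>v\<in>X'. \<alpha>' v = \<alpha> v) \<and> ?Inv r (X' \<union> Y) \<alpha>'"
    if Inv: "?Inv (Suc r) X \<alpha>" and X': "X' \<subseteq> X" "finite X'" "card X' \<le> p"
      and Y: "finite Y" "card Y \<le> q" for r X \<alpha> X' Y
  proof -
    obtain g x where g: "g < G" "Suc r * (p + q + 1) \<le> g" and x: "content m \<omega> x (sink m G) = 1"
      and \<alpha>: "follows_run_after m G \<omega> g x X' \<alpha>"
      using Inv X'(1) by (auto simp: follows_run_after_def)
    have "card (X' \<union> Y) < p + q + 1" using card_Un_le[of X' Y] X'(3) Y(2) by linarith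
    then obtain g' where g': "r * (p + q + 1) \<le> g'" "g' < Suc r * (p + q + 1)"
      and free: "\<And>v. v \<in> X' \<union> Y \<Longrightarrow> before_block m g' v \<or> after_block m g' v"
      using free_block_exists[of "X' \<union> Y" "p + q + 1" r m] X'(2) Y(1) by blast
    have "g' \<le> g" "0 < m" "g' < G" using g g' m by linarith+
    from follows_run_after_extend[OF sep this(2) g(1) this(1) x \<alpha> X'(2,3) free] this(3) g'(1)
    show ?thesis by blast
  qed
  obtain x where "run m \<omega> 0 (G * m * m) x = (\<lambda>_. 1)" using run_surj by blast
  then have "content m \<omega> x (sink m G) = 1" by (simp add: sink_def)
  then show "?Inv R {} \<alpha>" using R by (auto simp: follows_run_after_def)
qed

section \<open>Choice of parameters\<close>

lemma kary_structure_condensed: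
  assumes "set cs = condense nb \<Delta> ` C" "\<And>c. c \<in> C \<Longrightarrow> length (fst c) \<le> P" "P * \<Delta> \<le> k"
  shows "kary_structure k (xor_sig cs) (xor_struct n cs tw)"
proof (rule kary_structure_xor_struct)
  fix L b assume "(L, b) \<in> set cs"
  then obtain c where c: "c \<in> C" "(L, b) = condense nb \<Delta> c" using assms(1) by blast
  then have "length L = length (fst c) * \<Delta>" using length_condense[of nb \<Delta> c] by (metis fst_conv)
  also have "\<dots> \<le> P * \<Delta>" using assms(2)[OF c(1)] by (rule mult_right_mono) simp
  finally show "length L \<le> k" using assms(3) by simp
qed

lemma condensed_circuit_structures:
  fixes n d k D m G R :: nat and nb :: "nat \<times> nat \<Rightarrow> nat \<Rightarrow> nat"
  assumes D: "0 < D" "24 * D \<le> k" "k \<le> d" and m: "2 \<le> m" and n: "0 < n"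
    and sep: "separating m G (d + 2) \<omega>" and R: "R * (2 * d + 3) < G"
    and nb_less: "\<And>v i. v \<in> vertices m G \<Longrightarrow> i < 8 * D \<Longrightarrow> nb v i < n div 2"
    and expander: "expander (vertices m G) nb (8 * D) (6 * D) (12 * (d + 1))"
    and cs: "set cs = condense nb (8 * D) ` circuit_system m G \<omega>"
  shows "kary_structure k (xor_sig cs) (xor_struct n cs tw)"
    and "wl_distinguishes (xor_sig cs) k (xor_struct n cs False) (xor_struct n cs True)"
    and "r + d < R \<Longrightarrow>
      \<not> wl_distinguishes_after (xor_sig cs) d r (xor_struct n cs False) (xor_struct n cs True)"
proof -
  let ?V = "vertices m G" and ?C = "circuit_system m G \<omega>"
  show "kary_structure k (xor_sig cs) (xor_struct n cs tw)"
    using cs length_circuit_system by (rule kary_structure_condensed) (use D(2) in simp_all)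
  have "spoiler ?V fst (sink m G) ?C nb n k (8 * D) 3 cs"
  proof
    show "sink m G \<in> ?V" "([sink m G], 1) \<in> ?C"
      using m sink_in_vertices by (auto simp: circuit_system_def)
  qed (use circuit_system_derives nb_less cs D n in auto)
  then show "wl_distinguishes (xor_sig cs) k (xor_struct n cs False) (xor_struct n cs True)"
    by (rule spoiler.wl_distinguishes_xor_struct)
  have vars_C: "xor_vars ?C \<subseteq> ?V" using m by (intro xor_vars_circuit_system) simp
  then have vars: "xor_vars (set cs) \<subseteq> {..<n div 2}"
    using nb_less unfolding cs xor_vars_condense by (auto simp: nbhd_def)
  have condensation: "condensation ?V nb D d"
    by standard (use D expander in simp_all)
  have "d + 1 + 1 = d + 2" "d + 1 + (d + 1) + 1 = 2 * d + 3" by simp_all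
  with sep R have "duplicator_wins ?C (d + 1) (d + 1) R {} (\<lambda>_. 0)"
    by (intro duplicator_wins_circuit_system m) metis+
  then have "duplicator_wins (set cs) d 1 R {} (\<lambda>_. 0)"
    unfolding cs by (rule condensation.duplicator_wins_condense[OF condensation vars_C])
  then show "r + d < R \<Longrightarrow>
      \<not> wl_distinguishes_after (xor_sig cs) d r (xor_struct n cs False) (xor_struct n cs True)"
    by (intro not_wl_distinguishes_after_xor_struct[OF vars duplicator_wins_mono[where s = R]]) auto
qed

lemma hard_xor_structures_exist:
  fixes n d k D m G R :: nat
  assumes D: "0 < D" "24 * D \<le> k" "k \<le> d" and m: "2 \<le> m" and n: "2 \<le> n"
    and R: "R * (2 * d + 3) < G"
    and separation: "G * m * ((card (vertices m G) + 1) ^ (d + 2))\<^sup>2 < 2 ^ (m - 1)"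
    and expansion: "2 * card (vertices m G) * (12 * (d + 1)) ^ (8 * D) \<le> (n div 2) ^ (2 * D)"
  shows "\<exists>cs. (\<forall>tw. kary_structure k (xor_sig cs) (xor_struct n cs tw)) \<and>
    wl_distinguishes (xor_sig cs) k (xor_struct n cs False) (xor_struct n cs True) \<and>
    (\<forall>r. r + d < R \<longrightarrow>
      \<not> wl_distinguishes_after (xor_sig cs) d r (xor_struct n cs False) (xor_struct n cs True))"
proof -
  obtain \<omega> where sep: "separating m G (d + 2) \<omega>"
    using separating_exists[OF _ _ separation] m R by auto
  have "2 * card (vertices m G) * (12 * (d + 1)) ^ (8 * D) * (n div 2) ^ (6 * D) \<le>
      (n div 2) ^ (2 * D) * (n div 2) ^ (6 * D)"
    using expansion by (rule mult_right_mono) simp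
  also have "\<dots> = (n div 2) ^ (8 * D)" by (simp flip: power_add)
  finally obtain nb where nb: "\<And>v i. v \<in> vertices m G \<Longrightarrow> i < 8 * D \<Longrightarrow> nb v i < n div 2"
    "expander (vertices m G) nb (8 * D) (6 * D) (12 * (d + 1))"
    using expander_exists[OF finite_vertices, of m G "n div 2" "12 * (d + 1)" "8 * D" "6 * D"]
      sink_in_vertices[of m G] m n by fastforce
  obtain cs where cs: "set cs = condense nb (8 * D) ` circuit_system m G \<omega>"
    using finite_list[of "condense nb (8 * D) ` circuit_system m G \<omega>"] by auto
  have "0 < n" using n by simp
  from condensed_circuit_structures[OF D m this sep R nb cs] show ?thesis by blast
qed

lemma power_less_two_power:
  fixes n z :: nat
  assumes "100 * z\<^sup>2 \<le> n" "2 \<le> n"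
  shows "n ^ z < 2 ^ (n - 1)"
proof -
  have n: "0 < real n" "0 < sqrt (real n)" using assms(2) by simp_all
  have "(10 * real z)\<^sup>2 \<le> real n"
    using assms(1) by (simp add: power_mult_distrib flip: of_nat_le_iff[where 'a = real])
  then have z: "10 * real z \<le> sqrt (real n)" by (rule real_le_rsqrt)
  have "ln (real n) = 2 * ln (sqrt (real n))" using n by (simp add: ln_sqrt)
  also have "\<dots> \<le> 2 * sqrt (real n)" using ln_le_minus_one[OF n(2)] by simp
  finally have "real z * ln (real n) \<le> real z * (2 * sqrt (real n))" by (intro mult_left_mono) auto
  also have "\<dots> \<le> (sqrt (real n) / 10) * (2 * sqrt (real n))"
    using z by (intro mult_right_mono) auto
  also have "\<dots> = real n / 5" by simp
  also have "\<dots> < real (n - 1) * (1 / 2)" using assms(2) by (simp add: of_nat_diff)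
  also have "\<dots> \<le> real (n - 1) * ln 2"
    using ln_le_minus_one[of "1 / 2"] by (intro mult_left_mono) (auto simp: ln_div)
  finally have "ln (real n ^ z) < ln (2 ^ (n - 1))" using n by (simp add: ln_realpow)
  then have "real n ^ z < 2 ^ (n - 1)" using n by (subst (asm) ln_less_cancel_iff) auto
  then show ?thesis by (simp flip: of_nat_less_iff[where 'a = real])
qed

lemma separation_bound:
  fixes n d k D M N :: nat
  assumes "M \<le> n ^ D" "N + 1 \<le> n ^ D" "24 * D \<le> k" "0 < d" "100 * (k * d)\<^sup>2 \<le> n" "2 \<le> n"
  shows "M * ((N + 1) ^ (d + 2))\<^sup>2 < 2 ^ (n - 1)"
proof -
  have "M * ((N + 1) ^ (d + 2))\<^sup>2 \<le> n ^ D * ((n ^ D) ^ (d + 2))\<^sup>2"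
    using assms(1,2) by (intro mult_le_mono power_mono) auto
  also have "\<dots> = n ^ (D + D * (d + 2) * 2)" by (simp only: power_add power_mult)
  also have "\<dots> \<le> n ^ (k * d)"
  proof (rule power_increasing)
    have "D + D * (d + 2) * 2 = D * (2 * d + 5)" by (simp add: algebra_simps)
    also have "\<dots> \<le> D * (24 * d)" using assms(4) by (intro mult_left_mono) auto
    also have "\<dots> = (24 * D) * d" by simp
    also have "\<dots> \<le> k * d" using assms(3) by (rule mult_right_mono) simp
    finally show "D + D * (d + 2) * 2 \<le> k * d" .
  qed (use assms(6) in simp)
  also have "\<dots> < 2 ^ (n - 1)" using assms(5,6) by (rule power_less_two_power)
  finally show ?thesis .
qed

lemma expansion_bound:
  fixes n D N t :: nat
  assumes "2 * N \<le> n ^ D" "9 * t ^ 8 \<le> n" "2 \<le> n"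
  shows "2 * N * t ^ (8 * D) \<le> (n div 2) ^ (2 * D)"
proof -
  have "n * (9 * t ^ 8) \<le> n * n" using assms(2) by (rule mult_left_mono) simp
  also have "\<dots> \<le> (3 * (n div 2)) * (3 * (n div 2))"
    using assms(3) by (intro mult_le_mono) linarith+
  finally have square: "n * t ^ 8 \<le> (n div 2)\<^sup>2" by (simp add: power2_eq_square)
  have "2 * N * t ^ (8 * D) \<le> n ^ D * t ^ (8 * D)"
    using assms(1) by (rule mult_right_mono) simp
  also have "\<dots> = (n * t ^ 8) ^ D" by (simp only: power_mult power_mult_distrib)
  also have "\<dots> \<le> ((n div 2)\<^sup>2) ^ D" using square by (rule power_mono) simp
  also have "\<dots> = (n div 2) ^ (2 * D)" by (simp only: power_mult)
  finally show ?thesis .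
qed

lemma card_vertices: "card (vertices m G) = (G * m * m + 1) * m"
  by (simp add: vertices_def card_cartesian_product)

lemma card_vertices_bound:
  fixes n d e :: nat
  assumes "2 * d + 3 \<le> n" "0 < d"
  shows "2 * (card (vertices n ((n ^ e + 1) * (2 * d + 3))) + 1) \<le> n ^ (e + 7)"
proof -
  let ?G = "(n ^ e + 1) * (2 * d + 3)"
  have n: "4 \<le> n" using assms by simp
  have absorb: "2 * (y + 1) \<le> n * y" if "1 \<le> y" for y
  proof -
    have "2 * (y + 1) \<le> 4 * y" using that by simp
    also have "\<dots> \<le> n * y" using n by (rule mult_right_mono) simp
    finally show ?thesis .
  qed
  have pos: "1 \<le> n ^ i" for i using n by simp
  have "n ^ e + 1 \<le> n * n ^ e" by (rule order_trans[OF _ absorb[OF pos]]) simp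
  then have "?G * n * n \<le> n * n ^ e * n * n * n"
    using assms(1) by (intro mult_le_mono) auto
  also have "\<dots> = n ^ (e + 4)" by (simp add: power_add numeral_eq_Suc mult_ac)
  finally have "?G * n * n + 1 \<le> 2 * (n ^ (e + 4) + 1)" by simp
  also have "\<dots> \<le> n * n ^ (e + 4)" by (rule absorb[OF pos])
  finally have "?G * n * n + 1 \<le> n * n ^ (e + 4)" .
  then have "card (vertices n ?G) \<le> n * n ^ (e + 4) * n"
    unfolding card_vertices by (rule mult_right_mono) simp
  also have "\<dots> = n ^ (e + 6)" by (simp add: power_add numeral_eq_Suc mult_ac)
  finally have "2 * (card (vertices n ?G) + 1) \<le> 2 * (n ^ (e + 6) + 1)" by simp
  also have "\<dots> \<le> n * n ^ (e + 6)" by (rule absorb[OF pos])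
  finally have "2 * (card (vertices n ?G) + 1) \<le> n * n ^ (e + 6)" .
  then show ?thesis by (simp add: power_add numeral_eq_Suc mult_ac)
qed

lemma size_bounds:
  fixes n d k :: nat
  assumes k: "500 \<le> k" "k \<le> d" and n: "10 ^ 10 * d ^ 8 * k ^ 6 \<le> n"
  shows "2 * d + 3 \<le> n" and "100 * (k * d)\<^sup>2 \<le> n" and "9 * (12 * (d + 1)) ^ 8 \<le> n"
proof -
  have pow: "d \<le> d ^ 8" "d\<^sup>2 \<le> d ^ 8" "1 \<le> k ^ 6" "k\<^sup>2 \<le> k ^ 6"
    using k power_increasing[of 1 8 d] power_increasing[of 2 8 d] power_increasing[of 2 6 k] by auto
  have d8_bound: "10 ^ 10 * d ^ 8 \<le> n"
    using mult_left_mono[OF pow(3), of "10 ^ 10 * d ^ 8"] n by linarith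
  then show "2 * d + 3 \<le> n" using pow(1) k by simp
  have "100 * (k * d)\<^sup>2 \<le> 10 ^ 10 * (d\<^sup>2 * k\<^sup>2)" by (simp add: power_mult_distrib mult.commute)
  also have "\<dots> \<le> 10 ^ 10 * (d ^ 8 * k ^ 6)" using pow by (intro mult_left_mono mult_mono) auto
  also have "\<dots> \<le> n" using n by (simp add: mult.assoc)
  finally show "100 * (k * d)\<^sup>2 \<le> n" .
  have "(12 * (d + 1)) ^ 8 \<le> (13 * d) ^ 8" using k by (intro power_mono) auto
  also have "\<dots> = 815730721 * d ^ 8" by (simp add: power_mult_distrib)
  finally show "9 * (12 * (d + 1)) ^ 8 \<le> n" using d8_bound by simp
qed

proposition hard_pair_exists:
  fixes n d k :: nat
  assumes k: "500 \<le> k" "k \<le> d" and n: "10 ^ 10 * d ^ 8 * k ^ 6 \<le> n"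
  shows "\<exists>\<sigma> (A :: nat rel_struct) (B :: nat rel_struct).
    kary_structure k \<sigma> A \<and> kary_structure k \<sigma> B \<and>
    card (univ A) = n \<and> card (univ B) = n \<and> wl_distinguishes \<sigma> k A B \<and>
    (\<forall>r. r + d < n ^ (k div 24 - 7) \<longrightarrow> \<not> wl_distinguishes_after \<sigma> d r A B)"
proof -
  define e where "e = k div 24 - 7"
  define G where "G = (n ^ e + 1) * (2 * d + 3)"
  have D: "24 * (e + 7) \<le> k" using k by (simp add: e_def)
  note size = size_bounds[OF k n]
  have n_ge_2: "2 \<le> n" using size(1) by simp
  have N: "2 * (card (vertices n G) + 1) \<le> n ^ (e + 7)"
    unfolding G_def using size(1) k by (intro card_vertices_bound) auto
  have "G * n * 1 * 1 \<le> G * n * n * n" using n_ge_2 by (intro mult_le_mono) auto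
  also have "\<dots> \<le> card (vertices n G)" by (simp add: card_vertices)
  finally have "G * n \<le> n ^ (e + 7)" using N by simp
  then have separation: "G * n * ((card (vertices n G) + 1) ^ (d + 2))\<^sup>2 < 2 ^ (n - 1)"
    using N D k size(2) n_ge_2 by (intro separation_bound[where k = k and D = "e + 7"]) auto
  have expansion:
    "2 * card (vertices n G) * (12 * (d + 1)) ^ (8 * (e + 7)) \<le> (n div 2) ^ (2 * (e + 7))"
    using N size(3) n_ge_2 by (intro expansion_bound) auto
  have rounds: "n ^ e * (2 * d + 3) < G" by (simp add: G_def)
  obtain cs where "\<And>tw. kary_structure k (xor_sig cs) (xor_struct n cs tw)"
    "wl_distinguishes (xor_sig cs) k (xor_struct n cs False) (xor_struct n cs True)"
    "\<And>r. r + d < n ^ e \<Longrightarrow>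
      \<not> wl_distinguishes_after (xor_sig cs) d r (xor_struct n cs False) (xor_struct n cs True)"
    using hard_xor_structures_exist[OF _ D k(2) n_ge_2 n_ge_2 rounds separation expansion] by auto
  then show ?thesis
    by (intro exI[of _ "xor_sig cs"] exI[of _ "xor_struct n cs False"]
        exI[of _ "xor_struct n cs True"]) (auto simp: e_def)
qed

lemma rounds_bound:
  fixes n d k r :: nat
  assumes k: "500 \<le> k" and d: "d < n" and n: "2 \<le> n"
    and r: "real r \<le> real n powr (1 / 100 * real k)"
  shows "r + d < n ^ (k div 24 - 7)"
proof -
  have "real d < real n powr 1" using d by simp
  also have "\<dots> \<le> real n powr (1 / 100 * real k)" using n k by (intro powr_mono) auto
  finally have "real r + real d < 2 * real n powr (1 / 100 * real k)" using r by simp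
  also have "\<dots> \<le> real n powr 1 * real n powr (1 / 100 * real k)"
    using n by (intro mult_right_mono) auto
  also have "\<dots> = real n powr (1 + 1 / 100 * real k)" by (simp only: powr_add)
  also have "\<dots> \<le> real n powr real (k div 24 - 7)"
  proof (rule powr_mono)
    have "k \<le> 24 * (k div 24 - 7) + 191" by simp
    then have "real k \<le> 24 * real (k div 24 - 7) + 191" by linarith
    then show "1 + 1 / 100 * real k \<le> real (k div 24 - 7)" using k by linarith
  qed (use n in simp)
  also have "\<dots> = real (n ^ (k div 24 - 7))" using n by (simp add: powr_realpow)
  finally show ?thesis by linarith
qed

theorem theorem1p2:
  "\<exists>(k0::nat) (\<alpha>::real) (\<epsilon>::real). \<alpha> > 0 \<and> \<epsilon> > 0 \<and>
     (\<forall>(d::nat) (k::nat) (n::nat).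
        k0 \<le> k \<longrightarrow> k \<le> d \<longrightarrow> real n \<ge> \<alpha> * real d ^ 8 * real k ^ 6 \<longrightarrow>
        (\<exists>(\<sigma>::signature) (A::nat rel_struct) (B::nat rel_struct).
           kary_structure k \<sigma> A \<and> kary_structure k \<sigma> B \<and>
           card (univ A) = n \<and> card (univ B) = n \<and>
           wl_distinguishes \<sigma> k A B \<and>
           (\<forall>r::nat. real r \<le> real n powr (\<epsilon> * real k) \<longrightarrow>
              \<not> wl_distinguishes_after \<sigma> d r A B)))"
proof (rule exI[of _ 500], rule exI[of _ "10 ^ 10"], rule exI[of _ "1 / 100"],
    intro conjI allI impI)
  fix d k n :: nat
  assume k: "500 \<le> k" "k \<le> d" and "10 ^ 10 * real d ^ 8 * real k ^ 6 \<le> real n"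
  then have "real (10 ^ 10 * d ^ 8 * k ^ 6) \<le> real n" by simp
  then have n: "10 ^ 10 * d ^ 8 * k ^ 6 \<le> n" by (simp only: of_nat_le_iff)
  have "d < n" "2 \<le> n" using size_bounds(1)[OF k n] by linarith+
  then have rounds: "r + d < n ^ (k div 24 - 7)" if "real r \<le> real n powr (1 / 100 * real k)" for r
    using rounds_bound[OF k(1)] that by blast
  obtain \<sigma> and A B :: "nat rel_struct" where "kary_structure k \<sigma> A" "kary_structure k \<sigma> B"
    "card (univ A) = n" "card (univ B) = n" "wl_distinguishes \<sigma> k A B"
    "\<forall>r. r + d < n ^ (k div 24 - 7) \<longrightarrow> \<not> wl_distinguishes_after \<sigma> d r A B"
    using hard_pair_exists[OF k n] by blast
  with rounds show "\<exists>\<sigma> (A::nat rel_struct) (B::nat rel_struct).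
      kary_structure k \<sigma> A \<and> kary_structure k \<sigma> B \<and>
      card (univ A) = n \<and> card (univ B) = n \<and> wl_distinguishes \<sigma> k A B \<and>
      (\<forall>r::nat. real r \<le> real n powr (1 / 100 * real k) \<longrightarrow> \<not> wl_distinguishes_after \<sigma> d r A B)"
    by blast
qed simp_all

end
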